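(* Let $\mathcal F=\mathbb R[x_1,x_2,\ldots]$ and $$T=\frac12\sum_{\substack{a+b=p+q\\ a,b,p,q\ge 1}} x_a x_b\,\frac{\partial}{\partial x_p}\frac{\partial}{\partial x_q}.$$ Let $d\ge\ell\ge1$. Consider all sequences $(d_1,\ell_1),\ldots,(d_k,\ell_k)$, with $k\ge1$, satisfying: - $d_i>d_{i+1}+\ell_i$ for $i=1,\ldots,k-1$; - $d_k\ge\ell_k$; - $\sum_i d_i=d$ and $\sum_i\ell_i=\ell$; - $\ell_1,\ldots,\ell_k\ge1$. Then the eigenvalues of $T$ on $\mathcal F(d,\ell)$, counted with multiplicity, are exactly the numbers $$\lambda=\frac12\sum_{i=1}^k(\ell_i-1)(2d_i-\ell_i),$$ one for each such sequence.
   Context: $\mathcal F(d,\ell)$ is the span of all monomials $x_{i_1}\cdots x_{i_\ell}$ with $i_1+\cdots+i_\ell=d$. It is a finite-dimensional $T$-invariant subspace of $\mathcal F$. *)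

theory Defs
  imports
    "HOL-Analysis.Analysis"
    "HOL-Library.Poly_Mapping"
    "HOL-Library.Multiset"
    "Jordan_Normal_Form.Char_Poly"
begin

text \<open>
  A monomial is its finitely supported exponent vector and a polynomial is a finitely
  supported function from monomials to coefficients; the product is convolution.
  The type also contains a variable with index 0. It does not belong to the ring
  \<open>\<real>[x\<^sub>1, x\<^sub>2, \<dots>]\<close>, and is excluded below by requiring every index to be positive.
\<close>

type_synonym rpoly = "(nat \<Rightarrow>\<^sub>0 nat) \<Rightarrow>\<^sub>0 real"

instantiation poly_mapping :: (type, real_vector) real_vector
begin

lift_definition scaleR_poly_mapping :: "real \<Rightarrow> ('a \<Rightarrow>\<^sub>0 'b) \<Rightarrow> 'a \<Rightarrow>\<^sub>0 'b"
  is "\<lambda>c f m. c *\<^sub>R f m"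
  by (erule finite_subset[rotated]) auto

instance
  by standard (transfer; simp add: fun_eq_iff scaleR_add_right scaleR_add_left)+

end

definition var :: "nat \<Rightarrow> rpoly" where
  "var i = Poly_Mapping.single (Poly_Mapping.single i 1) 1"

text \<open>
  The truncated difference of exponents is harmless: if \<open>x\<^sub>i\<close> does not occur in the monomial
  \<open>m\<close>, the coefficient of the summand is 0.
\<close>

definition partial :: "nat \<Rightarrow> rpoly \<Rightarrow> rpoly" where
  "partial i f =
    (\<Sum>m\<in>Poly_Mapping.keys f.
      Poly_Mapping.single (m - Poly_Mapping.single i 1)
        (of_nat (Poly_Mapping.lookup m i) * Poly_Mapping.lookup f m))"

text \<open>
  For a fixed \<open>f\<close> only finitely many quadruples contribute
  (lemma \<open>finite_T_op_support\<close>), so \<open>Sum_any\<close> is the genuine sum.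
\<close>

definition T_term :: "rpoly \<Rightarrow> nat \<times> nat \<times> nat \<times> nat \<Rightarrow> rpoly" where
  "T_term f = (\<lambda>(a, b, p, q).
     if a + b = p + q \<and> a \<ge> 1 \<and> b \<ge> 1 \<and> p \<ge> 1 \<and> q \<ge> 1
     then var a * var b * partial p (partial q f) else 0)"

definition T_op :: "rpoly \<Rightarrow> rpoly" where
  "T_op f = (1 / 2) *\<^sub>R Sum_any (T_term f)"

definition F_space :: "nat \<Rightarrow> nat \<Rightarrow> rpoly set" where
  "F_space d l = span {prod_list (map var is) | is.
     length is = l \<and> (\<forall>i\<in>set is. i \<ge> 1) \<and> sum_list is = d}"

text \<open>
  \<open>M\<close> is the multiset of eigenvalues, with algebraic multiplicity, of the linear map \<open>T\<close> on the
  finite-dimensional \<open>T\<close>-invariant subspace \<open>V\<close>: the characteristic polynomial of the matrix of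
  \<open>T\<close> in a basis of \<open>V\<close> splits over the reals with exactly the roots \<open>M\<close>. The choice of the basis
  is immaterial because similar matrices have the same characteristic polynomial; invariance of
  \<open>V\<close> is part of the matrix equation.
\<close>

definition eigenvalues_on ::
  "('v::real_vector \<Rightarrow> 'v) \<Rightarrow> 'v set \<Rightarrow> real multiset \<Rightarrow> bool" where
  "eigenvalues_on T V M \<longleftrightarrow> linear T \<and>
    (\<exists>n vs A. length vs = n \<and> distinct vs \<and> independent (set vs) \<and> span (set vs) = V \<and>
       A \<in> carrier_mat n n \<and>
       (\<forall>j<n. T (vs ! j) = (\<Sum>i<n. (A $$ (i, j)) *\<^sub>R (vs ! i))) \<and>
       char_poly A = (\<Prod>\<mu>\<in>#M. [:- \<mu>, 1:]))"

text \<open>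
  The list \<open>[(d\<^sub>1, \<ell>\<^sub>1), \<dots>, (d\<^sub>k, \<ell>\<^sub>k)]\<close>, indexed from 0.
\<close>

definition admissible :: "nat \<Rightarrow> nat \<Rightarrow> (nat \<times> nat) list set" where
  "admissible d l = {s. s \<noteq> [] \<and>
     (\<forall>i. Suc i < length s \<longrightarrow> fst (s ! i) > fst (s ! Suc i) + snd (s ! i)) \<and>
     fst (last s) \<ge> snd (last s) \<and>
     sum_list (map fst s) = d \<and> sum_list (map snd s) = l \<and>
     (\<forall>x\<in>set s. snd x \<ge> 1)}"

definition seq_eigenvalue :: "(nat \<times> nat) list \<Rightarrow> real" where
  "seq_eigenvalue s = (1 / 2) * (\<Sum>(di, li)\<leftarrow>s. (real li - 1) * (2 * real di - real li))"

lemma finite_admissible: "finite (admissible d l)"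
proof (rule finite_subset)
  show "finite {s. set s \<subseteq> {..d} \<times> {..l} \<and> length s \<le> l}"
    by (rule finite_lists_length_le) auto
  show "admissible d l \<subseteq> {s. set s \<subseteq> {..d} \<times> {..l} \<and> length s \<le> l}"
  proof
    fix s assume s: "s \<in> admissible d l"
    have "length s \<le> sum_list (map snd s)" if "\<forall>x\<in>set s. snd x \<ge> 1" for s :: "(nat \<times> nat) list"
      using that by (induction s) auto
    moreover have "fst x \<le> sum_list (map fst s) \<and> snd x \<le> sum_list (map snd s)"
      if "x \<in> set s" for x
      using that by (auto intro!: member_le_sum_list)
    ultimately show "s \<in> {s. set s \<subseteq> {..d} \<times> {..l} \<and> length s \<le> l}"
      using s by (auto simp: admissible_def)
  qed
qed

lemma lookup_scaleR [simp]:
  "Poly_Mapping.lookup (c *\<^sub>R f) m = c *\<^sub>R Poly_Mapping.lookup f m"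
  by transfer simp

lemma lookup_partial:
  "Poly_Mapping.lookup (partial i f) m =
    of_nat (Suc (Poly_Mapping.lookup m i)) * Poly_Mapping.lookup f (m + Poly_Mapping.single i 1)"
proof -
  let ?e = "Poly_Mapping.single i (1::nat)"
  have *: "Poly_Mapping.lookup (Poly_Mapping.single (k - ?e)
        (of_nat (Poly_Mapping.lookup k i) * Poly_Mapping.lookup f k)) m =
      (if k = m + ?e then real (Suc (Poly_Mapping.lookup m i)) * Poly_Mapping.lookup f k else 0)" for k
  proof (cases "Poly_Mapping.lookup k i = 0")
    case True
    then have "k \<noteq> m + ?e" by (auto simp: lookup_add)
    with True show ?thesis by simp
  next
    case False
    then have "k - ?e = m \<longleftrightarrow> k = m + ?e"
      by (auto simp: poly_mapping_eq_iff fun_eq_iff lookup_add lookup_minus lookup_single when_def)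
    then show ?thesis by (auto simp: lookup_single lookup_add)
  qed
  show ?thesis
    unfolding partial_def lookup_sum * by (auto simp: sum.delta in_keys_iff)
qed

lemma linear_partial: "linear (partial i)"
  by (rule linearI; rule poly_mapping_eqI) (simp_all add: lookup_partial lookup_add algebra_simps)

lemma finite_partial_support: "finite {i. partial i f \<noteq> 0}"
proof (rule finite_subset)
  show "{i. partial i f \<noteq> 0} \<subseteq> (\<Union>m\<in>Poly_Mapping.keys f. Poly_Mapping.keys m)"
  proof
    fix i assume "i \<in> {i. partial i f \<noteq> 0}"
    then obtain m where "Poly_Mapping.lookup (partial i f) m \<noteq> 0"
      by (auto simp: poly_mapping_eq_iff fun_eq_iff)
    then have "m + Poly_Mapping.single i 1 \<in> Poly_Mapping.keys f"
      by (simp add: lookup_partial in_keys_iff)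
    moreover have "i \<in> Poly_Mapping.keys (m + Poly_Mapping.single i (1::nat))"
      by (simp add: in_keys_iff lookup_add)
    ultimately show "i \<in> (\<Union>m\<in>Poly_Mapping.keys f. Poly_Mapping.keys m)" by blast
  qed
qed simp

lemma finite_T_op_support: "finite {x. T_term f x \<noteq> 0}"
proof (rule finite_subset)
  let ?P = "SIGMA q:{q. partial q f \<noteq> 0}. {p. partial p (partial q f) \<noteq> 0}"
  let ?B = "\<Union>(q, p)\<in>?P. {..p + q} \<times> {..p + q} \<times> {p} \<times> {q}"
  have "finite ?P" by (intro finite_SigmaI finite_partial_support)
  then show "finite ?B" by auto
  have z: "partial p 0 = 0" for p by (simp add: partial_def)
  show "{x. T_term f x \<noteq> 0} \<subseteq> ?B"
    by (auto simp: T_term_def z split: if_splits)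
qed

lemma linear_T_op: "linear T_op"
proof (rule linearI)
  fix f g :: rpoly and c :: real
  have "T_term (f + g) = (\<lambda>x. T_term f x + T_term g x)"
    by (auto simp: T_term_def fun_eq_iff linear_add[OF linear_partial] algebra_simps)
  then show "T_op (f + g) = T_op f + T_op g"
    by (simp add: T_op_def Sum_any.distrib finite_T_op_support scaleR_add_right)
  have scale: "c *\<^sub>R h = Poly_Mapping.single 0 c * h" for h :: rpoly
    by (rule poly_mapping_eqI) (simp add: lookup_mult lookup_single when_mult)
  have t: "T_term (c *\<^sub>R f) = (\<lambda>x. Poly_Mapping.single 0 c * T_term f x)"
    by (auto simp: T_term_def fun_eq_iff linear_scale[OF linear_partial] mult_ac simp flip: scale)
      (simp_all add: scale mult_ac)
  have "T_op (c *\<^sub>R f) = (1 / 2) *\<^sub>R (c *\<^sub>R Sum_any (T_term f))"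
    unfolding T_op_def t scale[of "Sum_any (T_term f)"] Sum_any_right_distrib[OF finite_T_op_support] ..
  then show "T_op (c *\<^sub>R f) = c *\<^sub>R T_op f"
    by (simp add: T_op_def)
qed

end

theory Submission
  imports Defs "HOL-Library.List_Lexorder"
begin

text \<open>
  Substituting \<open>x\<^sub>a \<mapsto> c\<^sub>1 p\<^sub>1\<^sup>a + c\<^sub>2 p\<^sub>2\<^sup>a + \<dots>\<close> turns \<open>T\<close> into the operator
  \[ \sum_j \Big( (c_j \partial_{c_j} - 1)\, p_j \partial_{p_j} - \tfrac12 c_j^2 \partial_{c_j}^2 \Big)
     + \sum_{j \neq m} \frac{c_j c_m p_m}{p_j - p_m}\, \partial_{c_j}^2 . \]
  On \<open>\<Prod> c\<^sub>j\<^bsup>\<ell>\<^sub>j\<^esup> p\<^sub>j\<^bsup>d\<^sub>j\<^esup>\<close> the first sum acts by the scalar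
  \<open>\<onehalf> \<Sum> (\<ell>\<^sub>j - 1) (2 d\<^sub>j - \<ell>\<^sub>j)\<close>, and expanding the second one for \<open>\<bar>p\<^sub>1\<bar> > \<bar>p\<^sub>2\<bar> > \<dots>\<close> only produces terms
  that are smaller for the lexicographic order preferring large \<open>d\<^sub>1\<close>, then small \<open>\<ell>\<^sub>1\<close>, then large
  \<open>d\<^sub>2\<close>, and so on. So \<open>T\<close> is triangular with respect to leading exponents. Every leading exponent
  sequence is admissible: shifting by \<open>c p\<^sup>a\<close> and by \<open>- c p\<^sup>a\<close> cancels, which yields enough linear
  relations between the coefficients to exclude \<open>d\<^sub>i \<le> d\<^bsub>i+1\<^esub> + \<ell>\<^sub>i\<close>. Finally every admissible
  sequence occurs, because peeling off hooks embeds admissible sequences into the partitions of \<open>d\<close>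
  into \<open>\<ell>\<close> parts, which index a basis of \<open>F(d, \<ell>)\<close>.
\<close>

subsection \<open>Partial derivatives\<close>

lemma scaleR_eq_single_times: "c *\<^sub>R h = Poly_Mapping.single 0 c * (h::rpoly)"
  by (rule poly_mapping_eqI) (simp add: lookup_mult lookup_single when_mult)

lemma mult_scaleR_rpoly: "(g::rpoly) * (c *\<^sub>R h) = c *\<^sub>R (g * h)"
  by (simp add: scaleR_eq_single_times mult_ac)

lemma linear_mult_rpoly: "linear ((*) (g::rpoly))"
  by (rule linearI) (simp_all add: mult_scaleR_rpoly algebra_simps)

lemma partial_single: "partial i (Poly_Mapping.single m c) =
    Poly_Mapping.single (m - Poly_Mapping.single i 1) (of_nat (Poly_Mapping.lookup m i) * c)"
  by (cases "c = 0") (simp_all add: partial_def)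

lemma partial_var_mult:
  "partial i (var j * g) = var j * partial i g + (if i = j then g else 0)"
proof (induction g rule: update_induct)
  case const
  show ?case by (simp add: partial_def)
next
  case (update g m c)
  have "Poly_Mapping.update m c g = Poly_Mapping.single m c + g"
    using update(1)
    by (intro poly_mapping_eqI)
      (auto simp: lookup_update lookup_add lookup_single in_keys_iff when_def)
  \<comment> \<open>Truncated differences of exponents obey the usual laws only when
    \<open>x_i\<close> occurs in \<open>m\<close>; otherwise the coefficient is 0.\<close>
  moreover have "Poly_Mapping.single j 1 + m - Poly_Mapping.single i 1 =
      Poly_Mapping.single j 1 + (m - Poly_Mapping.single i 1)"
    if "Poly_Mapping.lookup m i \<noteq> 0"
    using that
    by (auto simp: poly_mapping_eq_iff fun_eq_iff lookup_add lookup_minus lookup_single when_def)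
  moreover have "Poly_Mapping.single i 1 + (m - Poly_Mapping.single i 1) = m"
    if "Poly_Mapping.lookup m i \<noteq> 0"
    using that
    by (auto simp: poly_mapping_eq_iff fun_eq_iff lookup_add lookup_minus lookup_single when_def)
  ultimately have "partial i (var j * Poly_Mapping.single m c) =
      var j * partial i (Poly_Mapping.single m c) + (if i = j then Poly_Mapping.single m c else 0)"
    by (cases "Poly_Mapping.lookup m i = 0")
      (auto simp: var_def mult_single partial_single lookup_add lookup_single algebra_simps
        simp flip: single_add)
  with update(3) \<open>Poly_Mapping.update m c g = _\<close> show ?case
    by (simp add: linear_add[OF linear_partial] algebra_simps)
qed

lemma partial_commute: "partial i (partial j f) = partial j (partial i f)"
proof (cases "i = j")
  case False
  then show ?thesis
    by (intro poly_mapping_eqI) (simp add: lookup_partial lookup_add lookup_single add_ac)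
qed simp

lemma partial_zero [simp]: "partial i 0 = 0"
  by (simp add: partial_def)

text \<open>Gives \<open>T\<close> as an ordinary finite sum, with \<open>b\<close> eliminated as
  \<open>p + q - a\<close>, so that sums can be interchanged. Since partial derivatives commute, the
  single bound \<open>M\<close> limits both \<open>p\<close> and \<open>q\<close>.\<close>

lemma T_op_eq:
  assumes "\<And>p. p > M \<Longrightarrow> partial p f = 0"
  shows "T_op f = (1/2) *\<^sub>R (\<Sum>p=1..M. \<Sum>q=1..M. \<Sum>a=1..<p+q. var a * (var (p + q - a) * partial p (partial q f)))"
proof -
  define S where "S = (\<lambda>(p,q,a). (a, p + q - a, p, q)) ` (SIGMA p:{1..M}. SIGMA q:{1..M}. {1..<p+q})"
  have sub: "{x. T_term f x \<noteq> 0} \<subseteq> S"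
  proof
    fix x assume x: "x \<in> {x. T_term f x \<noteq> 0}"
    obtain a b p q where [simp]: "x = (a,b,p,q)" by (metis prod.collapse)
    from x have 1: "a + b = p + q" "a \<ge> 1" "b \<ge> 1" "p \<ge> 1" "q \<ge> 1" "partial p (partial q f) \<noteq> 0"
      by (auto simp: T_term_def split: if_splits)
    then have "partial q f \<noteq> 0" "partial p f \<noteq> 0"
      using partial_commute[of p q] by (metis partial_zero)+
    with assms have "p \<le> M" "q \<le> M"
      by (meson not_le)+
    with 1 have "(p,q,a) \<in> (SIGMA p:{1..M}. SIGMA q:{1..M}. {1..<p+q})" "b = p + q - a" by auto
    then show "x \<in> S" unfolding S_def by force
  qed
  have "Sum_any (T_term f) = sum (T_term f) S"
    by (rule Sum_any.expand_superset) (use sub in \<open>auto simp: S_def\<close>)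
  also have "\<dots> = (\<Sum>(p,q,a)\<in>(SIGMA p:{1..M}. SIGMA q:{1..M}. {1..<p+q}). var a * (var (p + q - a) * partial p (partial q f)))"
    unfolding S_def
    by (subst sum.reindex) (auto simp: inj_on_def T_term_def mult_ac intro!: sum.cong)
  also have "\<dots> = (\<Sum>p=1..M. \<Sum>q=1..M. \<Sum>a=1..<p+q. var a * (var (p + q - a) * partial p (partial q f)))"
    by (simp add: sum.Sigma)
  finally show ?thesis by (simp add: T_op_def)
qed

lemma partial_support_bound:
  obtains M where "\<And>p. p > M \<Longrightarrow> partial p f = 0"
proof -
  obtain M where "\<forall>p\<in>{i. partial i f \<noteq> 0}. p \<le> M"
    using finite_partial_support[of f] finite_nat_set_iff_bounded_le by blast
  then show ?thesis using that[of M] by (meson linorder_not_less mem_Collect_eq)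
qed

subsection \<open>Shifting all variables by a geometric sequence\<close>

text \<open>
  \<open>shift_coeff m e f\<close> is the coefficient of \<open>c\<^sup>m p\<^sup>e\<close> in \<open>f(x\<^sub>1 + c p, x\<^sub>2 + c p\<^sup>2, \<dots>)\<close>, that is, in
  \<open>exp (c \<Sum>\<^sub>a p\<^sup>a \<partial>\<^sub>a) f\<close>. The indices are integers so that \<open>m - 1\<close> and \<open>e - a\<close> do not truncate.
\<close>

primrec shift_coeff_nat :: "nat \<Rightarrow> int \<Rightarrow> rpoly \<Rightarrow> rpoly" where
  "shift_coeff_nat 0 e f = (if e = 0 then f else 0)"
| "shift_coeff_nat (Suc m) e f =
    (1 / real (Suc m)) *\<^sub>R (\<Sum>a=1..nat e. partial a (shift_coeff_nat m (e - int a) f))"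

definition shift_coeff :: "int \<Rightarrow> int \<Rightarrow> rpoly \<Rightarrow> rpoly" where
  "shift_coeff m e f = (if m < 0 then 0 else shift_coeff_nat (nat m) e f)"

lemma shift_coeff_neg [simp]: "m < 0 \<Longrightarrow> shift_coeff m e f = 0"
  by (simp add: shift_coeff_def)

lemma shift_coeff_0: "shift_coeff 0 e f = (if e = 0 then f else 0)"
  by (simp add: shift_coeff_def)

lemma shift_coeff_Suc: "shift_coeff (int (Suc m)) e f =
    (1 / real (Suc m)) *\<^sub>R (\<Sum>a=1..nat e. partial a (shift_coeff (int m) (e - int a) f))"
  by (simp add: shift_coeff_def del: of_nat_Suc)

lemma shift_coeff_induct [case_names neg 0 Suc]:
  assumes "\<And>m. m < 0 \<Longrightarrow> P m" "P 0" "\<And>m. P (int m) \<Longrightarrow> P (int (Suc m))"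
  shows "P m"
proof (cases "m < 0")
  case False
  then obtain n where "m = int n" by (metis nonneg_int_cases not_less)
  moreover have "P (int n)" by (induction n) (use assms in auto)
  ultimately show ?thesis by simp
qed (use assms in auto)

lemma linear_shift_coeff: "linear (shift_coeff m e)"
proof (induction m arbitrary: e rule: shift_coeff_induct)
  case (Suc m)
  show ?case
    by (rule linearI) (simp_all only: shift_coeff_Suc linear_add[OF Suc] linear_scale[OF Suc]
        linear_add[OF linear_partial] linear_scale[OF linear_partial] sum.distrib scaleR_add_right
        scaleR_sum_right scaleR_left_commute)
qed (auto intro!: linearI simp: shift_coeff_0)

lemma shift_coeff_zero [simp]: "shift_coeff m e 0 = 0"
  using linear_0[OF linear_shift_coeff] .

text \<open>Each of the \<open>m\<close> derivatives has an index of at least 1, so it adds at least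
  1 to the exponent of \<open>p\<close>.\<close>

lemma shift_coeff_eq_0: "e < m \<Longrightarrow> shift_coeff m e f = 0"
proof (induction m arbitrary: e rule: shift_coeff_induct)
  case (Suc m)
  then show ?case by (auto simp: shift_coeff_Suc simp del: of_nat_Suc intro!: sum.neutral)
qed (auto simp: shift_coeff_0)

lemma shift_coeff_eq_0': "e < 0 \<Longrightarrow> shift_coeff m e f = 0"
  by (cases "m < 0") (auto intro: shift_coeff_eq_0)

lemma shift_coeff_partial: "shift_coeff m e (partial i f) = partial i (shift_coeff m e f)"
proof (induction m arbitrary: e rule: shift_coeff_induct)
  case (Suc m)
  show ?case
    by (simp only: shift_coeff_Suc Suc linear_scale[OF linear_partial] linear_sum[OF linear_partial]
        partial_commute[of _ i])
qed (auto simp: shift_coeff_0)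

lemma shift_coeff_commute:
  "shift_coeff m e (shift_coeff m' e' f) = shift_coeff m' e' (shift_coeff m e f)"
proof (induction m arbitrary: e rule: shift_coeff_induct)
  case (Suc m)
  show ?case
    by (simp only: shift_coeff_Suc Suc linear_scale[OF linear_shift_coeff]
        linear_sum[OF linear_shift_coeff] shift_coeff_partial)
qed (auto simp: shift_coeff_0)

text \<open>The coefficient form of \<open>c d/dc exp (c X) = c X exp (c X)\<close>, where
  \<open>X\<close> is the sum of \<open>p^a\<close> times the \<open>a\<close>-th partial
  derivative. The bound \<open>M\<close> does not depend on the exponents, unlike
  \<open>nat e\<close>, which allows sums to be swapped later.\<close>

lemma scaleR_shift_coeff:
  assumes M: "\<And>p. p > M \<Longrightarrow> partial p f = 0"
  shows "of_int m *\<^sub>R shift_coeff m e f = (\<Sum>a=1..M. partial a (shift_coeff (m - 1) (e - int a) f))"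
proof (induction m rule: shift_coeff_induct)
  case (Suc m)
  have "(\<Sum>a=1..nat e. partial a (shift_coeff m (e - int a) f)) =
      (\<Sum>a=1..max M (nat e). partial a (shift_coeff m (e - int a) f))"
    by (intro sum.mono_neutral_left) (auto simp: shift_coeff_eq_0')
  also have "\<dots> = (\<Sum>a=1..M. partial a (shift_coeff m (e - int a) f))"
    by (intro sum.mono_neutral_right) (auto simp: M simp flip: shift_coeff_partial)
  finally show ?case by (simp add: shift_coeff_Suc del: of_nat_Suc) (simp add: scaleR_scaleR)
qed (auto simp: shift_coeff_0)

text \<open>The coefficient form of \<open>p d/dp exp (c X) = c (p dX/dp) exp (c X)\<close>; the
  weight \<open>a\<close> comes from differentiating \<open>p^a\<close>.\<close>

lemma scaleR_shift_coeff_weight: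
  assumes M: "\<And>p. p > M \<Longrightarrow> partial p f = 0"
  shows "of_int e *\<^sub>R shift_coeff m e f =
    (\<Sum>a=1..M. real a *\<^sub>R partial a (shift_coeff (m - 1) (e - int a) f))"
proof (induction m arbitrary: e rule: shift_coeff_induct)
  case (Suc m)
  let ?S = "\<Sum>a=1..M. real a *\<^sub>R partial a (shift_coeff (int m) (e - int a) f)"
  have "of_int (int (Suc m)) *\<^sub>R of_int e *\<^sub>R shift_coeff (Suc m) e f =
      of_int e *\<^sub>R (\<Sum>a=1..M. partial a (shift_coeff (int m) (e - int a) f))"
    by (subst scaleR_left_commute, subst scaleR_shift_coeff[OF M]) auto
  \<comment> \<open>Split \<open>e\<close> as \<open>(e - a) + a\<close>: the first part falls to
    the induction hypothesis and becomes \<open>m\<close> times \<open>?S\<close>, the second is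
    \<open>?S\<close> itself.\<close>
  also have "\<dots> = (\<Sum>a=1..M. partial a (of_int (e - int a) *\<^sub>R shift_coeff (int m) (e - int a) f)) + ?S"
    by (simp add: scaleR_sum_right linear_scale[OF linear_partial] flip: sum.distrib scaleR_add_left)
  also have "(\<Sum>a=1..M. partial a (of_int (e - int a) *\<^sub>R shift_coeff (int m) (e - int a) f)) =
      (\<Sum>a=1..M. \<Sum>b=1..M. partial a (real b *\<^sub>R partial b (shift_coeff (int m - 1) (e - int a - int b) f)))"
    by (simp only: Suc linear_sum[OF linear_partial])
  also have "\<dots> = (\<Sum>b=1..M. \<Sum>a=1..M. partial a (real b *\<^sub>R partial b (shift_coeff (int m - 1) (e - int a - int b) f)))"
    by (rule sum.swap)
  also have "\<dots> = (\<Sum>b=1..M. real b *\<^sub>R partial b (\<Sum>a=1..M. partial a (shift_coeff (int m - 1) (e - int b - int a) f)))"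
    by (simp add: scaleR_sum_right linear_scale[OF linear_partial] linear_sum[OF linear_partial]
        partial_commute[of _ "_::nat"] algebra_simps cong: sum.cong)
  also have "\<dots> = of_int (int m) *\<^sub>R ?S"
    by (subst scaleR_shift_coeff[OF M, symmetric])
      (auto simp: scaleR_sum_right linear_scale[OF linear_partial] mult_ac)
  finally have "real (Suc m) *\<^sub>R of_int e *\<^sub>R shift_coeff (Suc m) e f = real (Suc m) *\<^sub>R ?S"
    by (simp add: scaleR_add_left)
  then show ?case
    by (simp only: scaleR_cancel_left) auto
qed (auto simp: shift_coeff_0)

text \<open>Substitution is a ring homomorphism sending \<open>x_b\<close> to
  \<open>x_b + c p^b\<close>; the second term collects the factor \<open>c p^b\<close>.\<close>

lemma shift_coeff_var_mult:
  assumes "b \<ge> 1"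
  shows "shift_coeff m e (var b * g) = var b * shift_coeff m e g + shift_coeff (m - 1) (e - int b) g"
proof (induction m arbitrary: e rule: shift_coeff_induct)
  case (Suc m)
  obtain M1 where M1: "\<And>p. p > M1 \<Longrightarrow> partial p g = 0" using partial_support_bound by blast
  define M where "M = max b M1"
  have M: "\<And>p. p > M \<Longrightarrow> partial p g = 0" and bM: "b \<in> {1..M}"
    using M1 assms by (auto simp: M_def)
  have M': "\<And>p. p > M \<Longrightarrow> partial p (var b * g) = 0"
    using M bM by (auto simp: partial_var_mult)
  have swap: "e - x - int b = e - int b - x" for x by simp
  have "of_int (int (Suc m)) *\<^sub>R shift_coeff (int (Suc m)) e (var b * g) =
      (\<Sum>a=1..M. partial a (var b * shift_coeff (int m) (e - int a) g + shift_coeff (int m - 1) (e - int a - int b) g))"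
    by (subst scaleR_shift_coeff[OF M']) (simp_all add: Suc)
  also have "\<dots> = var b * (\<Sum>a=1..M. partial a (shift_coeff (int m) (e - int a) g)) +
      (\<Sum>a=1..M. if a = b then shift_coeff (int m) (e - int a) g else 0) +
      (\<Sum>a=1..M. partial a (shift_coeff (int m - 1) (e - int b - int a) g))"
    by (simp add: linear_add[OF linear_partial] partial_var_mult sum.distrib sum_distrib_left
        swap)
  also have "\<dots> = var b * (of_int (int (Suc m)) *\<^sub>R shift_coeff (int (Suc m)) e g) +
      shift_coeff (int m) (e - int b) g + of_int (int m) *\<^sub>R shift_coeff (int m) (e - int b) g"
    by (subst (1 2) scaleR_shift_coeff[OF M]) (use bM in \<open>auto simp: sum.delta\<close>)
  also have "\<dots> = of_int (int (Suc m)) *\<^sub>R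
      (var b * shift_coeff (int (Suc m)) e g + shift_coeff (int (Suc m) - 1) (e - int b) g)"
    by (simp add: mult_scaleR_rpoly algebra_simps)
  finally show ?case
    by (simp del: of_nat_Suc)
qed (auto simp: shift_coeff_0)

text \<open>Shifting turns the factor \<open>x_a x_b\<close> into four terms: the old product
  reproduces \<open>T\<close>, the two mixed terms vanish because \<open>(m, e)\<close> is leading,
  and \<open>c^2 p^(a+b)\<close> contributes the scalar, one summand of the eigenvalue.\<close>

lemma shift_coeff_T_op:
  assumes "e > 0"
    and top: "\<And>m' e'. e' > e \<or> e' = e \<and> m' < m \<Longrightarrow> shift_coeff m' e' f = 0"
  shows "shift_coeff m e (T_op f) = T_op (shift_coeff m e f) +
    (of_int (m - 1) * of_int (2 * e - m) / 2) *\<^sub>R shift_coeff m e f"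
proof -
  obtain M where M: "\<And>p. p > M \<Longrightarrow> partial p f = 0" using partial_support_bound by blast
  note lins = linear_add[OF linear_partial] linear_scale[OF linear_partial] linear_sum[OF linear_partial]
  have T_eq: "T_op f = (1/2) *\<^sub>R (\<Sum>p=1..M. \<Sum>q=1..M. \<Sum>a=1..<p+q.
      var a * (var (p + q - a) * partial p (partial q f)))"
    by (rule T_op_eq) (rule M)
  have sc: "(\<Sum>a=1..M. partial a (shift_coeff (k - 1) (j - int a) f)) = of_int k *\<^sub>R shift_coeff k j f" for k j
    by (rule scaleR_shift_coeff[symmetric]) (rule M)
  have wt: "(\<Sum>a=1..M. real a *\<^sub>R partial a (shift_coeff (k - 1) (j - int a) f)) = of_int j *\<^sub>R shift_coeff k j f" for k j
    by (rule scaleR_shift_coeff_weight[symmetric]) (rule M)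
  define P where "P = (\<lambda>k j p q. partial p (partial q (shift_coeff k j f)))"
  have expand: "shift_coeff m e (var a * (var (p + q - a) * partial p (partial q f))) =
      var a * (var (p + q - a) * P m e p q) + var a * P (m - 1) (e - int (p + q - a)) p q +
      var (p + q - a) * P (m - 1) (e - int a) p q + P (m - 2) (e - int p - int q) p q"
    if "a \<in> {1..<p+q}" for a p q
  proof -
    define b where "b = p + q - a"
    \<comment> \<open>Because \<open>a + b = p + q\<close>, the \<open>c^2\<close> term does not
      depend on \<open>a\<close>.\<close>
    have b: "b \<ge> 1" "a \<ge> 1" and eq: "e - int a - int b = e - int p - int q"
      using that by (auto simp: b_def)
    show ?thesis
      unfolding b_def[symmetric]
      by (simp add: shift_coeff_var_mult[OF b(1)] shift_coeff_var_mult[OF b(2)] shift_coeff_partial P_def eq distrib_left add.assoc)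
  qed
  define S1 where "S1 = (\<Sum>p=1..M. \<Sum>q=1..M. \<Sum>a=1..<p+q. var a * (var (p + q - a) * P m e p q))"
  define S2 where "S2 = (\<Sum>p=1..M. \<Sum>q=1..M. \<Sum>a=1..<p+q. var a * P (m - 1) (e - int (p + q - a)) p q)"
  define S3 where "S3 = (\<Sum>p=1..M. \<Sum>q=1..M. \<Sum>a=1..<p+q. var (p + q - a) * P (m - 1) (e - int a) p q)"
  define S4 where "S4 = (\<Sum>p=1..M. \<Sum>q=1..M. \<Sum>a=1..<p+q. P (m - 2) (e - int p - int q) p q)"
  have "shift_coeff m e (T_op f) = (1/2) *\<^sub>R (S1 + S2 + S3 + S4)"
    unfolding T_eq linear_scale[OF linear_shift_coeff] linear_sum[OF linear_shift_coeff]
      S1_def S2_def S3_def S4_def sum.distrib[symmetric]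
    by (intro arg_cong[where f = "scaleR (1/2)"] sum.cong refl expand)
  moreover have "(1/2) *\<^sub>R S1 = T_op (shift_coeff m e f)"
    unfolding S1_def P_def
    by (rule T_op_eq[symmetric]) (simp add: M flip: shift_coeff_partial)
  moreover have "S3 = S2"
    unfolding S3_def S2_def
  proof (rule sum.cong[OF refl], rule sum.cong[OF refl])
    fix p q
    show "(\<Sum>a=1..<p+q. var (p + q - a) * P (m - 1) (e - int a) p q) =
        (\<Sum>a=1..<p+q. var a * P (m - 1) (e - int (p + q - a)) p q)"
      by (rule sum.reindex_bij_witness[of _ "\<lambda>a. p + q - a" "\<lambda>a. p + q - a"]) auto
  qed
  \<comment> \<open>Without the constraint \<open>a < p + q\<close> the sum over \<open>p\<close> and \<open>q\<close> is a multiple of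
    \<open>shift_coeff (m + 1) (e + a) f\<close>; this and the added terms vanish by assumption.\<close>
  moreover have "S2 = 0"
  proof -
    have inner: "(\<Sum>a=1..<p+q. var a * P (m - 1) (e - int (p + q - a)) p q) =
        (\<Sum>a=1..2*M. var a * P (m - 1) (e + int a - int p - int q) p q)" if "p \<in> {1..M}" "q \<in> {1..M}" for p q
    proof (rule sum.mono_neutral_cong_left)
      show "\<forall>i\<in>{1..2*M} - {1..<p+q}. var i * P (m - 1) (e + int i - int p - int q) p q = 0"
      proof
        fix i assume i: "i \<in> {1..2*M} - {1..<p+q}"
        have "shift_coeff (m - 1) (e + int i - int p - int q) f = 0"
          by (rule top) (use i in auto)
        then show "var i * P (m - 1) (e + int i - int p - int q) p q = 0"
          by (simp add: P_def)
      qed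
    qed (use that in \<open>auto simp: algebra_simps of_nat_diff\<close>)
    have "S2 = (\<Sum>p=1..M. \<Sum>q=1..M. \<Sum>a=1..2*M. var a * P (m - 1) (e + int a - int p - int q) p q)"
      unfolding S2_def by (rule sum.cong[OF refl], rule sum.cong[OF refl], rule inner)
    also have "\<dots> = (\<Sum>p=1..M. \<Sum>a=1..2*M. \<Sum>q=1..M. var a * P (m - 1) (e + int a - int p - int q) p q)"
      by (intro sum.cong refl sum.swap)
    also have "\<dots> = (\<Sum>a=1..2*M. \<Sum>p=1..M. \<Sum>q=1..M. var a * P (m - 1) (e + int a - int p - int q) p q)"
      by (rule sum.swap)
    also have "\<dots> = (\<Sum>a=1..2*M. var a * (\<Sum>p=1..M. partial p (\<Sum>q=1..M. partial q (shift_coeff (m - 1) (e + int a - int p - int q) f))))"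
      by (simp add: P_def sum_distrib_left lins)
    also have "\<dots> = (\<Sum>a=1..2*M. var a * (\<Sum>p=1..M. partial p (of_int m *\<^sub>R shift_coeff m (e + int a - int p) f)))"
      by (simp only: sc)
    also have "\<dots> = (\<Sum>a=1..2*M. var a * (of_int m *\<^sub>R (\<Sum>p=1..M. partial p (shift_coeff (m + 1 - 1) (e + int a - int p) f))))"
      by (simp add: lins scaleR_sum_right)
    also have "\<dots> = 0"
      unfolding sc by (simp add: top)
    finally show ?thesis .
  qed
  moreover have "S4 = (of_int (m - 1) * of_int (2 * e - m)) *\<^sub>R shift_coeff m e f"
  proof -
    let ?Q = "\<lambda>p q. P (m - 2) (e - int p - int q) p q"
    have 1: "(\<Sum>p=1..M. \<Sum>q=1..M. real p *\<^sub>R ?Q p q) = (of_int (m - 1) * of_int e) *\<^sub>R shift_coeff m e f"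
    proof -
      have "(\<Sum>p=1..M. \<Sum>q=1..M. real p *\<^sub>R ?Q p q) =
          (\<Sum>p=1..M. real p *\<^sub>R partial p (\<Sum>q=1..M. partial q (shift_coeff (m - 1 - 1) (e - int p - int q) f)))"
        by (simp add: P_def scaleR_sum_right lins)
      also have "\<dots> = of_int (m - 1) *\<^sub>R (\<Sum>p=1..M. real p *\<^sub>R partial p (shift_coeff (m - 1) (e - int p) f))"
        by (simp only: sc lins scaleR_sum_right scaleR_left_commute)
      finally show ?thesis
        by (simp only: wt) simp
    qed
    have 2: "(\<Sum>p=1..M. \<Sum>q=1..M. real q *\<^sub>R ?Q p q) = (of_int (m - 1) * of_int e) *\<^sub>R shift_coeff m e f"
    proof -
      have "(\<Sum>p=1..M. \<Sum>q=1..M. real q *\<^sub>R ?Q p q) = (\<Sum>q=1..M. \<Sum>p=1..M. real q *\<^sub>R ?Q p q)"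
        by (rule sum.swap)
      also have "\<dots> = (\<Sum>q=1..M. \<Sum>p=1..M. real q *\<^sub>R ?Q q p)"
      proof (intro sum.cong refl arg_cong[where f = "scaleR _"])
        show "?Q p q = ?Q q p" for p q
          unfolding P_def partial_commute[of p q] by (simp add: algebra_simps)
      qed
      finally show ?thesis using 1 by simp
    qed
    have 3: "(\<Sum>p=1..M. \<Sum>q=1..M. ?Q p q) = (of_int (m - 1) * of_int m) *\<^sub>R shift_coeff m e f"
    proof -
      have "(\<Sum>p=1..M. \<Sum>q=1..M. ?Q p q) =
          (\<Sum>p=1..M. partial p (\<Sum>q=1..M. partial q (shift_coeff (m - 1 - 1) (e - int p - int q) f)))"
        by (simp add: P_def lins)
      also have "\<dots> = (\<Sum>p=1..M. partial p (of_int (m - 1) *\<^sub>R shift_coeff (m - 1) (e - int p) f))"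
        by (simp only: sc)
      also have "\<dots> = of_int (m - 1) *\<^sub>R (\<Sum>p=1..M. partial p (shift_coeff (m - 1) (e - int p) f))"
        by (simp only: lins scaleR_sum_right)
      finally show ?thesis
        by (simp only: sc) simp
    qed
    \<comment> \<open>The summand is constant in \<open>a\<close>, which takes
      \<open>p + q - 1\<close> values. By the two Euler identities the three pieces add up to
      \<open>(m - 1) (e + e - m)\<close>.\<close>
    have "S4 = (\<Sum>p=1..M. \<Sum>q=1..M. (real p + real q - 1) *\<^sub>R ?Q p q)"
      unfolding S4_def by (intro sum.cong refl) (simp add: sum_constant_scaleR of_nat_diff del: sum_constant)
    also have "\<dots> = (\<Sum>p=1..M. \<Sum>q=1..M. real p *\<^sub>R ?Q p q) + (\<Sum>p=1..M. \<Sum>q=1..M. real q *\<^sub>R ?Q p q) -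
        (\<Sum>p=1..M. \<Sum>q=1..M. ?Q p q)"
      by (simp add: sum.distrib sum_subtractf algebra_simps)
    finally show ?thesis
      unfolding 1 2 3 by (simp add: algebra_simps flip: scaleR_add_left scaleR_diff_left)
  qed
  ultimately show ?thesis by (simp add: scaleR_add_right)
qed

subsection \<open>Relations between shifts\<close>

text \<open>Weights are products of \<open>k\<close> linear factors, so that Euler operators can be
  peeled off one at a time. The constant \<open>c\<close> may differ from factor to factor, which
  makes the class stable under translations.\<close>

inductive poly_deg :: "nat \<Rightarrow> (int \<Rightarrow> int \<Rightarrow> real) \<Rightarrow> bool" where
  one: "poly_deg 0 (\<lambda>m e. 1)"
| mult_fst: "poly_deg k P \<Longrightarrow> poly_deg (Suc k) (\<lambda>m e. (of_int m - c) * P m e)"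
| mult_snd: "poly_deg k P \<Longrightarrow> poly_deg (Suc k) (\<lambda>m e. (of_int e - c) * P m e)"

lemma poly_deg_shift: "poly_deg k P \<Longrightarrow> poly_deg k (\<lambda>m e. P (m + i) (e + j))"
proof (induction rule: poly_deg.induct)
  case one
  show ?case by (rule poly_deg.one)
next
  case (mult_fst k P c)
  from poly_deg.mult_fst[OF this(2), of "c - of_int i"] show ?case by (simp add: algebra_simps)
next
  case (mult_snd k P c)
  from poly_deg.mult_snd[OF this(2), of "c - of_int j"] show ?case by (simp add: algebra_simps)
qed

lemma poly_deg_prod_fst:
  "finite A \<Longrightarrow> poly_deg k P \<Longrightarrow> poly_deg (card A + k) (\<lambda>m e. (\<Prod>c\<in>A. of_int m - of_int c) * P m e)"
  by (induction A rule: finite_induct) (auto dest: poly_deg.mult_fst simp: mult.assoc)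

lemma poly_deg_prod_snd:
  "finite A \<Longrightarrow> poly_deg k P \<Longrightarrow> poly_deg (card A + k) (\<lambda>m e. (\<Prod>c\<in>A. of_int e - of_int c) * P m e)"
  by (induction A rule: finite_induct) (auto dest: poly_deg.mult_snd simp: mult.assoc)

definition alt_sum :: "(int \<Rightarrow> int \<Rightarrow> real) \<Rightarrow> int \<Rightarrow> int \<Rightarrow> rpoly \<Rightarrow> rpoly" where
  "alt_sum P L E f = (\<Sum>m=0..L. \<Sum>e=0..E.
     ((-1) ^ nat m * P m e) *\<^sub>R shift_coeff m e (shift_coeff (L - m) (E - e) f))"

lemma sum_int_shift:
  fixes h :: "int \<Rightarrow> 'a::comm_monoid_add"
  assumes "\<And>m. m < k \<Longrightarrow> h m = 0" "k \<ge> 0"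
  shows "(\<Sum>m=0..L. h m) = (\<Sum>m=0..L-k. h (m + k))"
proof -
  have "(\<Sum>m=0..L. h m) = (\<Sum>m=k..L. h m)"
    by (rule sum.mono_neutral_right) (use assms in auto)
  also have "\<dots> = (\<Sum>m=0..L-k. h (m + k))"
    by (rule sum.reindex_bij_witness[of _ "\<lambda>m. m + k" "\<lambda>m. m - k"]) auto
  finally show ?thesis .
qed

text \<open>
  \<open>alt_sum 1 L E f\<close> is the coefficient of \<open>c\<^sup>L p\<^sup>E\<close> in \<open>exp (- c X) exp (c X) f = f\<close> with
  \<open>X = \<Sum>\<^sub>a p\<^sup>a \<partial>\<^sub>a\<close>, hence 0 for \<open>L > 0\<close>. A weight of degree \<open>k\<close> applies \<open>k\<close> Euler operators in
  \<open>c\<close> and \<open>p\<close> to the first factor and so creates at most \<open>c\<^sup>k\<close>.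
\<close>

lemma alt_sum_weight:
  assumes "\<And>m e m' e'. W m e *\<^sub>R shift_coeff m e (shift_coeff m' e' f) =
    (\<Sum>a=1..M. w a *\<^sub>R partial a (shift_coeff (m - 1) (e - int a) (shift_coeff m' e' f)))"
  shows "alt_sum (\<lambda>m e. W m e * P m e) L E f =
    - (\<Sum>a=1..M. w a *\<^sub>R partial a (alt_sum (\<lambda>m e. P (m + 1) (e + int a)) (L - 1) (E - int a) f))"
proof -
  note lins = linear_scale[OF linear_partial] linear_sum[OF linear_partial]
  define G where "G = (\<lambda>a m e. (((-1) ^ nat m) * P m e) *\<^sub>R
    shift_coeff (m - 1) (e - int a) (shift_coeff (L - m) (E - e) f))"
  have "alt_sum (\<lambda>m e. W m e * P m e) L E f = (\<Sum>m=0..L. \<Sum>e=0..E. \<Sum>a=1..M. w a *\<^sub>R partial a (G a m e))"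
  proof -
    have "((-1) ^ nat m * (W m e * P m e)) *\<^sub>R shift_coeff m e (shift_coeff (L - m) (E - e) f) =
        (\<Sum>a=1..M. w a *\<^sub>R partial a (G a m e))" for m e
    proof -
      have "((-1) ^ nat m * (W m e * P m e)) *\<^sub>R shift_coeff m e (shift_coeff (L - m) (E - e) f) =
          ((-1) ^ nat m * P m e) *\<^sub>R (W m e *\<^sub>R shift_coeff m e (shift_coeff (L - m) (E - e) f))"
        by (simp add: mult_ac)
      also have "\<dots> = (\<Sum>a=1..M. w a *\<^sub>R partial a (G a m e))"
        unfolding assms G_def by (simp add: lins scaleR_sum_right mult_ac)
      finally show ?thesis .
    qed
    then show ?thesis
      unfolding alt_sum_def by (intro sum.cong refl)
  qed
  also have "\<dots> = (\<Sum>m=0..L. \<Sum>a=1..M. \<Sum>e=0..E. w a *\<^sub>R partial a (G a m e))"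
    by (intro sum.cong refl sum.swap)
  also have "\<dots> = (\<Sum>a=1..M. \<Sum>m=0..L. \<Sum>e=0..E. w a *\<^sub>R partial a (G a m e))"
    by (rule sum.swap)
  also have "\<dots> = (\<Sum>a=1..M. w a *\<^sub>R partial a (\<Sum>m=0..L. \<Sum>e=0..E. G a m e))"
    by (simp add: lins scaleR_sum_right)
  also have "\<dots> = (\<Sum>a=1..M. w a *\<^sub>R partial a (- alt_sum (\<lambda>m e. P (m + 1) (e + int a)) (L - 1) (E - int a) f))"
  proof (intro sum.cong refl arg_cong[where f = "\<lambda>x. _ *\<^sub>R partial _ x"])
    fix a
    \<comment> \<open>Terms with \<open>e < a\<close> or \<open>m < 1\<close> vanish, so both ranges
      can be translated. Passing from \<open>m\<close> to \<open>m + 1\<close> changes the parity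
      and yields the minus sign.\<close>
    have "(\<Sum>m=0..L. \<Sum>e=0..E. G a m e) = (\<Sum>m=0..L. \<Sum>e=0..E - int a. G a m (e + int a))"
      by (intro sum.cong refl sum_int_shift) (auto simp: G_def shift_coeff_eq_0')
    also have "\<dots> = (\<Sum>m=0..L - 1. \<Sum>e=0..E - int a. G a (m + 1) (e + int a))"
      by (rule sum_int_shift) (auto simp: G_def)
    also have "\<dots> = - alt_sum (\<lambda>m e. P (m + 1) (e + int a)) (L - 1) (E - int a) f"
      unfolding alt_sum_def G_def
      by (auto simp: nat_add_distrib algebra_simps simp flip: sum_negf intro!: sum.cong)
    finally show "(\<Sum>m=0..L. \<Sum>e=0..E. G a m e) =
      - alt_sum (\<lambda>m e. P (m + 1) (e + int a)) (L - 1) (E - int a) f" .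
  qed
  finally show ?thesis
    by (simp add: sum_negf linear_neg[OF linear_partial])
qed

lemma alt_sum_diff:
  "alt_sum (\<lambda>m e. P m e - Q m e) L E f = alt_sum P L E f - alt_sum Q L E f"
  by (simp add: alt_sum_def algebra_simps flip: sum_subtractf)

lemma alt_sum_scale: "alt_sum (\<lambda>m e. c * P m e) L E f = c *\<^sub>R alt_sum P L E f"
  by (simp add: alt_sum_def scaleR_sum_right mult_ac)

lemma alt_sum_eq_0:
  assumes "poly_deg k P" "int k < L"
  shows "alt_sum P L E f = 0"
proof -
  obtain M where M: "\<And>p. p > M \<Longrightarrow> partial p f = 0" using partial_support_bound by blast
  then have M': "\<And>p. p > M \<Longrightarrow> partial p (shift_coeff m e f) = 0" for m e
    by (simp flip: shift_coeff_partial)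
  note lins = linear_scale[OF linear_partial] linear_sum[OF linear_partial]
  have fst: "alt_sum (\<lambda>m e. of_int m * P m e) L E f =
      - (\<Sum>a=1..M. 1 *\<^sub>R partial a (alt_sum (\<lambda>m e. P (m + 1) (e + int a)) (L - 1) (E - int a) f))" for P L E
    by (rule alt_sum_weight) (simp add: scaleR_shift_coeff[OF M'])
  have snd: "alt_sum (\<lambda>m e. of_int e * P m e) L E f =
      - (\<Sum>a=1..M. real a *\<^sub>R partial a (alt_sum (\<lambda>m e. P (m + 1) (e + int a)) (L - 1) (E - int a) f))" for P L E
    by (rule alt_sum_weight) (simp add: scaleR_shift_coeff_weight[OF M'])
  show ?thesis
    using assms
  proof (induction k arbitrary: P L E)
    case 0
    then have P: "P = (\<lambda>m e. 1)" by (auto elim: poly_deg.cases)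
    \<comment> \<open>Here the Euler operator in \<open>c\<close> acts on the second factor, with
      the opposite result of its action on the first. The weights \<open>L - m\<close> and
      \<open>m\<close> add up to \<open>L\<close>, so \<open>L\<close> times the sum is 0, and
      \<open>L > 0\<close>.\<close>
    have "alt_sum (\<lambda>m e. of_int (L - m) * P m e) L E f =
       (\<Sum>a=1..M. partial a (alt_sum P (L - 1) (E - int a) f))"
    proof -
      define G where "G = (\<lambda>a m e. ((-1) ^ nat m) *\<^sub>R shift_coeff m e (shift_coeff (L - m - 1) (E - e - int a) f) :: rpoly)"
      have "alt_sum (\<lambda>m e. of_int (L - m) * P m e) L E f =
         (\<Sum>m=0..L. \<Sum>e=0..E. \<Sum>a=1..M. partial a (G a m e))"
        unfolding alt_sum_def P
      proof (intro sum.cong refl)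
        fix m e
        have "((-1) ^ nat m * (of_int (L - m) * 1)) *\<^sub>R shift_coeff m e (shift_coeff (L - m) (E - e) f) =
            (-1) ^ nat m *\<^sub>R shift_coeff m e (of_int (L - m) *\<^sub>R shift_coeff (L - m) (E - e) f)"
          by (simp add: linear_scale[OF linear_shift_coeff])
        also have "of_int (L - m) *\<^sub>R shift_coeff (L - m) (E - e) f =
            (\<Sum>a=1..M. partial a (shift_coeff (L - m - 1) (E - e - int a) f))"
          by (rule scaleR_shift_coeff) (rule M)
        also have "(-1) ^ nat m *\<^sub>R shift_coeff m e \<dots> = (\<Sum>a=1..M. partial a (G a m e))"
          by (simp only: G_def lins linear_sum[OF linear_shift_coeff] shift_coeff_partial scaleR_sum_right)
        finally show "((-1) ^ nat m * (of_int (L - m) * 1)) *\<^sub>R shift_coeff m e (shift_coeff (L - m) (E - e) f) =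
            (\<Sum>a=1..M. partial a (G a m e))" .
      qed
      also have "\<dots> = (\<Sum>m=0..L. \<Sum>a=1..M. \<Sum>e=0..E. partial a (G a m e))"
        by (intro sum.cong refl sum.swap)
      also have "\<dots> = (\<Sum>a=1..M. \<Sum>m=0..L. \<Sum>e=0..E. partial a (G a m e))"
        by (rule sum.swap)
      also have "\<dots> = (\<Sum>a=1..M. partial a (\<Sum>m=0..L. \<Sum>e=0..E. G a m e))"
        by (simp add: lins)
      also have "\<dots> = (\<Sum>a=1..M. partial a (alt_sum P (L - 1) (E - int a) f))"
      proof (intro sum.cong refl arg_cong[where f = "partial _"])
        fix a
        have "(\<Sum>m=0..L. \<Sum>e=0..E. G a m e) = (\<Sum>m=0..L. \<Sum>e=0..E - int a. G a m e)"
          by (intro sum.cong refl sum.mono_neutral_right) (auto simp: G_def shift_coeff_eq_0')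
        also have "\<dots> = (\<Sum>m=0..L - 1. \<Sum>e=0..E - int a. G a m e)"
          by (rule sum.mono_neutral_right) (auto simp: G_def)
        finally show "(\<Sum>m=0..L. \<Sum>e=0..E. G a m e) = alt_sum P (L - 1) (E - int a) f"
          by (simp add: alt_sum_def G_def P algebra_simps)
      qed
      finally show ?thesis .
    qed
    also have "\<dots> = alt_sum (\<lambda>m e. - of_int m * P m e) L E f"
      using fst[of P L E] alt_sum_scale[of "-1" "\<lambda>m e. of_int m * P m e" L E f] by (simp add: P)
    finally have "alt_sum (\<lambda>m e. of_int (L - m) * P m e - (- of_int m * P m e)) L E f = 0"
      by (subst alt_sum_diff) simp
    then have "of_int L *\<^sub>R alt_sum P L E f = 0"
      by (subst alt_sum_scale[symmetric]) (simp add: algebra_simps)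
    with 0 show ?case by simp
  next
    case (Suc k)
    from Suc.prems(1) show ?case
    proof cases
      case (mult_fst Q c)
      \<comment> \<open>Removing the factor \<open>m\<close> lowers both the degree and
        \<open>L\<close> by one, so the strict inequality persists.\<close>
      have "alt_sum (\<lambda>m e. of_int m * Q m e) L E f = 0"
        unfolding fst using Suc.IH[OF poly_deg_shift[OF mult_fst(2)], of "L - 1"] Suc.prems(2)
        by (simp add: sum.neutral)
      moreover have "alt_sum Q L E f = 0"
        using Suc.IH[OF mult_fst(2)] Suc.prems(2) by simp
      ultimately show ?thesis
        unfolding mult_fst(1) left_diff_distrib alt_sum_diff alt_sum_scale by simp
    next
      case (mult_snd Q c)
      have "alt_sum (\<lambda>m e. of_int e * Q m e) L E f = 0"
        unfolding snd using Suc.IH[OF poly_deg_shift[OF mult_snd(2)], of "L - 1"] Suc.prems(2)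
        by (simp add: sum.neutral)
      moreover have "alt_sum Q L E f = 0"
        using Suc.IH[OF mult_snd(2)] Suc.prems(2) by simp
      ultimately show ?thesis
        unfolding mult_snd(1) left_diff_distrib alt_sum_diff alt_sum_scale by simp
    qed
  qed
qed

text \<open>Cancelling a shift by its opposite gives linear relations among the products of two
  coefficients with total exponents \<open>(m + m2, e + e2)\<close>. As \<open>(m, e)\<close> is
  leading, a suitable weight isolates one product. This is the source of the gap condition
  \<open>d_i > d_(i+1) + l_i\<close>.\<close>

lemma shift_coeff_gap:
  assumes "m \<ge> 1" "e \<ge> 1" "m2 \<ge> 1" "e2 + m \<ge> e"
    and top: "\<And>m' e'. e' > e \<or> e' = e \<and> m' < m \<Longrightarrow> shift_coeff m' e' f = 0"
  shows "shift_coeff m2 e2 (shift_coeff m e f) = 0"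
proof -
  consider "e2 < m2" | "e2 > e" | "e2 \<ge> 1" "e2 \<le> e" using assms by linarith
  then show ?thesis
  proof cases
    case 1
    then show ?thesis by (rule shift_coeff_eq_0)
  next
    case 2
    then show ?thesis using top by (simp add: shift_coeff_commute[of m2])
  next
    case 3
    define L where "L = m + m2"
    \<comment> \<open>This weight has degree less than \<open>L\<close> and kills every term of the sum that is not known to vanish,
      except the one at \<open>(m, e)\<close>.\<close>
    define P where "P = (\<lambda>m' e' :: int. (\<Prod>c\<in>{e2..<e}. real_of_int e' - of_int c) *
      ((\<Prod>c\<in>{m+1..<L}. real_of_int m' - of_int c) * 1))"
    have "poly_deg (card {e2..<e} + (card {m+1..<L} + 0)) P"
      unfolding P_def by (intro poly_deg_prod_fst poly_deg_prod_snd poly_deg.one) auto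
    \<comment> \<open>The degree is \<open>(e - e2) + (m2 - 1)\<close>, which is below
      \<open>L = m + m2\<close> exactly because \<open>e \<le> e2 + m\<close>.\<close>
    then have "alt_sum P L (e + e2) f = 0"
      by (rule alt_sum_eq_0) (use assms 3 in \<open>auto simp: L_def\<close>)
    also have "alt_sum P L (e + e2) f = (\<Sum>m'=0..L. \<Sum>e'=0..e + e2. if m' = m \<and> e' = e then
       ((-1) ^ nat m * P m e) *\<^sub>R shift_coeff m e (shift_coeff m2 e2 f) else 0)"
      unfolding alt_sum_def
    proof (intro sum.cong refl)
      fix m' e' assume m': "m' \<in> {0..L}"
      \<comment> \<open>Besides the surviving term: \<open>top\<close> kills the first factor if
        \<open>e' > e\<close>, or if \<open>e' = e\<close> and \<open>m' < m\<close>, and the second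
        factor if \<open>e' < e2\<close>. The weight kills the two middle ranges. At
        \<open>m' = L\<close> the second factor has exponent 0 in \<open>c\<close> but
        \<open>e2 \<ge> 1\<close> in \<open>p\<close>.\<close>
      consider "m' = m" "e' = e" | "e' > e" | "e' < e2" | "e2 \<le> e'" "e' < e" | "e' = e" "m' < m"
        | "e' = e" "m < m'" "m' < L" | "e' = e" "m' = L" using m' by force
      then show "((-1) ^ nat m' * P m' e') *\<^sub>R shift_coeff m' e' (shift_coeff (L - m') (e + e2 - e') f) =
         (if m' = m \<and> e' = e then ((-1) ^ nat m * P m e) *\<^sub>R shift_coeff m e (shift_coeff m2 e2 f) else 0)"
      proof cases
        case 2
        then show ?thesis by (simp add: shift_coeff_commute[of m'] top)
      next
        case 4
        then have "P m' e' = 0" unfolding P_def by auto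
        with 4 show ?thesis by simp
      next
        case 5
        then show ?thesis by (simp add: shift_coeff_commute[of m'] top)
      next
        case 6
        then have "P m' e' = 0" unfolding P_def by auto
        with 6 show ?thesis by simp
      qed (use 3 assms in \<open>auto simp: L_def top shift_coeff_0\<close>)
    qed
    also have "\<dots> = (\<Sum>m'=0..L. if m' = m then ((-1) ^ nat m * P m e) *\<^sub>R shift_coeff m e (shift_coeff m2 e2 f) else 0)"
      by (intro sum.cong refl) (use assms 3 in \<open>auto simp: sum.delta\<close>)
    also have "\<dots> = ((-1) ^ nat m * P m e) *\<^sub>R shift_coeff m e (shift_coeff m2 e2 f)"
      using assms by (simp add: L_def)
    finally have "P m e = 0 \<or> shift_coeff m e (shift_coeff m2 e2 f) = 0"
      by simp
    moreover have "P m e \<noteq> 0" unfolding P_def by auto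
    ultimately show ?thesis by (simp add: shift_coeff_commute[of m2])
  qed
qed

subsection \<open>The homogeneous components\<close>

definition monom_list :: "nat list \<Rightarrow> rpoly" where
  "monom_list is = prod_list (map var is)"

lemma monom_list_simps [simp]:
  "monom_list [] = 1" "monom_list (i # is) = var i * monom_list is"
  by (simp_all add: monom_list_def)

lemma F_space_eq: "F_space d l =
    span (monom_list ` {is. length is = l \<and> (\<forall>i\<in>set is. i \<ge> 1) \<and> sum_list is = d})"
  unfolding F_space_def monom_list_def by (rule arg_cong[where f = span]) auto

lemma subspace_F_space: "subspace (F_space d l)"
  by (simp add: F_space_eq)

lemma monom_list_in_F_space:
  "(\<forall>i\<in>set is. i \<ge> 1) \<Longrightarrow> monom_list is \<in> F_space (sum_list is) (length is)"
  unfolding F_space_eq by (intro span_base) auto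

lemma F_space_induct [consumes 1, case_names monom zero add scale]:
  assumes "f \<in> F_space d l"
    and "\<And>is. \<lbrakk>length is = l; \<forall>i\<in>set is. i \<ge> 1; sum_list is = d\<rbrakk> \<Longrightarrow> P (monom_list is)"
    and "P 0" "\<And>f g. P f \<Longrightarrow> P g \<Longrightarrow> P (f + g)" "\<And>c f. P f \<Longrightarrow> P (c *\<^sub>R f)"
  shows "P f"
  using assms(1) unfolding F_space_eq
  by (rule span_induct) (use assms in \<open>auto simp: subspace_def\<close>)

lemma F_space_linear_image:
  assumes "linear g" "f \<in> F_space d l"
    and "\<And>is. \<lbrakk>length is = l; \<forall>i\<in>set is. i \<ge> 1; sum_list is = d\<rbrakk> \<Longrightarrow> g (monom_list is) \<in> F_space d' l'"
  shows "g f \<in> F_space d' l'"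
  using assms(2)
  by (induction rule: F_space_induct)
    (auto simp: assms linear_add linear_scale linear_0 subspace_F_space subspace_add subspace_scale subspace_0)

lemma var_mult_F_space:
  assumes "j \<ge> 1" "f \<in> F_space d l"
  shows "var j * f \<in> F_space (j + d) (Suc l)"
proof (rule F_space_linear_image[OF linear_mult_rpoly assms(2)])
  fix "is" :: "nat list"
  assume "length is = l" "\<forall>i\<in>set is. i \<ge> 1" "sum_list is = d"
  then show "var j * monom_list is \<in> F_space (j + d) (Suc l)"
    using monom_list_in_F_space[of "j # is"] assms(1) by simp
qed

lemma partial_one [simp]: "partial i 1 = 0"
  using partial_single[of i 0 1] by simp

lemma partial_monom_list_gt: "i > sum_list is \<Longrightarrow> partial i (monom_list is) = 0"
  by (induction "is") (auto simp: partial_var_mult)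

lemma partial_monom_list:
  assumes "i \<ge> 1" "\<forall>j\<in>set is. j \<ge> 1"
  shows "partial i (monom_list is) \<in> F_space (sum_list is - i) (length is - 1)"
  using assms(2)
proof (induction "is")
  case (Cons j "is")
  have "var j * partial i (monom_list is) \<in> F_space (j + sum_list is - i) (length is)"
  \<comment> \<open>For larger \<open>i\<close> the derivative is 0, so the truncated subtraction
    does no harm.\<close>
  proof (cases "i \<le> sum_list is")
    case True
    with assms(1) have "is \<noteq> []" by auto
    moreover have "j + sum_list is - i = j + (sum_list is - i)" using True by simp
    ultimately show ?thesis
      using Cons var_mult_F_space[of j "partial i (monom_list is)"] by (cases "is") auto
  qed (auto simp: partial_monom_list_gt subspace_0 subspace_F_space)
  moreover have "monom_list is \<in> F_space (sum_list is) (length is)"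
    using Cons.prems by (intro monom_list_in_F_space) auto
  ultimately show ?case
    by (auto simp: partial_var_mult intro: subspace_add[OF subspace_F_space])
qed (auto simp: subspace_0 subspace_F_space)

lemma partial_F_space:
  assumes "f \<in> F_space d l" "i \<ge> 1"
  shows "partial i f \<in> F_space (d - i) (l - 1)"
  using partial_monom_list[OF assms(2)]
  by (intro F_space_linear_image[OF linear_partial assms(1)]) auto

lemma partial_F_space_gt:
  assumes "f \<in> F_space d l" "i > d"
  shows "partial i f = 0"
  using assms(1)
  by (induction rule: F_space_induct)
    (use assms(2) in \<open>auto simp: partial_monom_list_gt linear_add[OF linear_partial] linear_scale[OF linear_partial]\<close>)

lemma partial_F_space_0:
  assumes "f \<in> F_space d 0"
  shows "partial i f = 0"
  using assms
  by (induction rule: F_space_induct)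
    (auto simp: linear_add[OF linear_partial] linear_scale[OF linear_partial])

lemma F_space_0_eq: "f \<in> F_space d 0 \<Longrightarrow> f = Poly_Mapping.lookup f 0 *\<^sub>R 1"
proof (induction rule: F_space_induct)
  case (scale c f)
  then show ?case by (metis lookup_scaleR real_scaleR_def scaleR_scaleR)
qed (auto simp: lookup_add scaleR_add_left)

lemma F_space_0_pos: "f \<in> F_space d 0 \<Longrightarrow> d > 0 \<Longrightarrow> f = 0"
  by (induction rule: F_space_induct) auto

text \<open>Euler's identity in degree \<open>l\<close>; for \<open>l \<ge> 1\<close> it recovers
  \<open>f\<close> from its derivatives.\<close>

lemma euler_F_space:
  assumes "f \<in> F_space d l"
  shows "(\<Sum>i=1..d. var i * partial i f) = real l *\<^sub>R f"
  using assms
proof (induction rule: F_space_induct)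
  case (monom "is")
  have "(\<Sum>i=1..d. var i * partial i (monom_list is)) = real (length is) *\<^sub>R monom_list is"
    if "\<forall>i\<in>set is. i \<in> {1..d}" for "is"
    using that
  proof (induction "is")
    case (Cons j "is")
    have "(\<Sum>i=1..d. var i * partial i (monom_list (j # is))) =
        var j * (\<Sum>i=1..d. var i * partial i (monom_list is)) +
        (\<Sum>i=1..d. if i = j then var i * monom_list is else 0)"
      unfolding monom_list_simps partial_var_mult sum_distrib_left sum.distrib[symmetric]
      by (intro sum.cong refl) (auto simp: algebra_simps)
    then show ?case
      using Cons by (simp add: mult_scaleR_rpoly scaleR_add_left)
  qed simp
  moreover have "\<forall>i\<in>set is. i \<in> {1..d}"
    using monom member_le_sum_list by auto
  ultimately show ?case using monom by blast
qed (auto simp: linear_add[OF linear_partial] linear_scale[OF linear_partial] mult_scaleR_rpoly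
    sum.distrib algebra_simps scaleR_sum_right[symmetric])

lemma F_space_eqI_0:
  assumes "f \<in> F_space d l" "l \<ge> 1" "\<And>i. i \<in> {1..d} \<Longrightarrow> partial i f = 0"
  shows "f = 0"
  using euler_F_space[OF assms(1)] assms(2,3) by simp

lemma shift_coeff_F_space_0:
  assumes "f \<in> F_space d l" "e > int d \<or> m > int l"
  shows "shift_coeff m e f = 0"
  using assms
proof (induction m arbitrary: e d l f rule: shift_coeff_induct)
  case (Suc m)
  have "partial a (shift_coeff (int m) (e - int a) f) = 0" if "a \<ge> 1" for a
  proof (cases "a > d \<or> l = 0")
    case True
    then show ?thesis
      using Suc.prems partial_F_space_gt partial_F_space_0
      by (auto simp flip: shift_coeff_partial)
  next
    case False
    then have "shift_coeff (int m) (e - int a) (partial a f) = 0"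
      using Suc.prems(2) by (intro Suc.IH[OF partial_F_space[OF Suc.prems(1) that]]) auto
    then show ?thesis by (simp add: shift_coeff_partial)
  qed
  then show ?case by (auto simp: shift_coeff_Suc simp del: of_nat_Suc intro!: sum.neutral)
qed (auto simp: shift_coeff_0)

lemma shift_coeff_F_space:
  assumes "f \<in> F_space d l"
  shows "shift_coeff (int m) (int e) f \<in> F_space (d - e) (l - m)"
  using assms
proof (induction m arbitrary: e d l f)
  case 0
  then show ?case by (auto simp: shift_coeff_0 subspace_0 subspace_F_space)
next
  case (Suc m)
  have "partial a (shift_coeff (int m) (int e - int a) f) \<in> F_space (d - e) (l - Suc m)"
    if "a \<in> {1..e}" for a
    using Suc.IH[OF partial_F_space[OF Suc.prems, of a], of "e - a"] that
    by (cases "a \<le> d")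
      (auto simp: shift_coeff_partial of_nat_diff partial_F_space_gt[OF Suc.prems] subspace_0 subspace_F_space
        simp flip: shift_coeff_partial)
  then show ?case
    unfolding shift_coeff_Suc
    by (intro subspace_scale subspace_F_space subspace_sum) auto
qed

lemma T_op_F_space:
  assumes "f \<in> F_space d l"
  shows "T_op f \<in> F_space d l"
proof -
  have "var a * (var (p + q - a) * partial p (partial q f)) \<in> F_space d l"
    if "p \<ge> 1" "q \<ge> 1" "a \<in> {1..<p+q}" for a p q
  \<comment> \<open>In the other case the second derivative vanishes, so truncated differences do
    not matter.\<close>
  proof (cases "p + q \<le> d \<and> l \<ge> 2")
    case True
    have "partial p (partial q f) \<in> F_space (d - q - p) (l - 1 - 1)"
      using that assms by (intro partial_F_space)
    then have "var a * (var (p + q - a) * partial p (partial q f)) \<in>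
        F_space (a + (p + q - a + (d - q - p))) (Suc (Suc (l - 1 - 1)))"
      using that by (intro var_mult_F_space) auto
    moreover have "a + (p + q - a + (d - q - p)) = d" "Suc (Suc (l - 1 - 1)) = l"
      using that True by auto
    ultimately show ?thesis by simp
  next
    case False
    have "partial p (partial q f) = 0"
    proof (cases "q > d \<or> l = 0")
      case True
      then show ?thesis
        using partial_F_space_gt[OF assms] partial_F_space_0[of f] assms by auto
    next
      case nqd: False
      have "partial q f \<in> F_space (d - q) (l - 1)"
        using assms that by (intro partial_F_space)
      moreover have "p > d - q \<or> l - 1 = 0" using False nqd by auto
      ultimately show ?thesis
        using partial_F_space_gt partial_F_space_0 by metis
    qed
    then show ?thesis by (simp add: subspace_0 subspace_F_space)
  qed
  moreover have "T_op f = (1/2) *\<^sub>R (\<Sum>p=1..d. \<Sum>q=1..d. \<Sum>a=1..<p+q.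
      var a * (var (p + q - a) * partial p (partial q f)))"
    by (rule T_op_eq) (rule partial_F_space_gt[OF assms])
  ultimately show ?thesis
    by (auto intro!: subspace_scale subspace_sum subspace_F_space)
qed

lemma T_op_F_space_0: "f \<in> F_space d 0 \<Longrightarrow> T_op f = 0"
  using T_op_eq[of d f] partial_F_space_0[of f d] by simp

subsection \<open>Triangular operators\<close>

text \<open>\<open>V\<close> is cut down by the functionals in order of decreasing key. The kernel
  of the top one is \<open>T\<close>-invariant, because \<open>T\<close> acts on that functional by
  a scalar, and has codimension at most 1. The list \<open>ss\<close> records the indices at which
  the dimension drops.\<close>

lemma triangular_basis_exists:
  fixes T :: "'v::real_vector \<Rightarrow> 'v" and \<phi> :: "'e \<Rightarrow> 'v \<Rightarrow> real" and key :: "'e \<Rightarrow> 'k::linorder"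
  assumes "finite I" "inj_on key I" "linear T" "\<And>e. linear (\<phi> e)"
    and "subspace V" "\<And>f. f \<in> V \<Longrightarrow> T f \<in> V"
    and "\<And>f. f \<in> V \<Longrightarrow> \<forall>e\<in>I. \<phi> e f = 0 \<Longrightarrow> f = 0"
    and "\<And>e f. e \<in> I \<Longrightarrow> f \<in> V \<Longrightarrow> \<forall>e'\<in>I. key e' > key e \<longrightarrow> \<phi> e' f = 0 \<Longrightarrow>
      \<phi> e (T f) = ev e * \<phi> e f"
  shows "\<exists>vs ss. length vs = length ss \<and> distinct vs \<and> independent (set vs) \<and> span (set vs) = V \<and>
    distinct ss \<and>
    set ss \<subseteq> {e\<in>I. \<exists>f\<in>V. (\<forall>e'\<in>I. key e' > key e \<longrightarrow> \<phi> e' f = 0) \<and> \<phi> e f \<noteq> 0} \<and>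
    (\<forall>j<length ss. T (vs ! j) - ev (ss ! j) *\<^sub>R vs ! j \<in> span (set (take j vs)))"
  using assms(1,2,5-)
proof (induction "card I" arbitrary: I V)
  case 0
  then have "V = {0}" by (auto simp: subspace_0)
  then show ?case by (intro exI[of _ "[]"]) (auto simp: independent_empty)
next
  case (Suc n)
  note linphi = linear_add[OF assms(4)] linear_diff[OF assms(4)] linear_scale[OF assms(4)] linear_0[OF assms(4)]
  have "I \<noteq> {}" using Suc.hyps(2) by auto
  then have "Max (key ` I) \<in> key ` I" using Suc.prems(1) by (intro Max_in) auto
  then obtain e where e: "e \<in> I" "key e = Max (key ` I)" by force
  then have max: "key e' \<le> key e" if "e' \<in> I" for e' using that Suc.prems(1) by simp
  have less: "key e' < key e" if "e' \<in> I - {e}" for e'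
    using max[of e'] that e(1) Suc.prems(2) by (metis Diff_iff inj_onD insertI1 order_le_imp_less_or_eq)
  define W where "W = {f\<in>V. \<phi> e f = 0}"
  have subW: "subspace W"
    using Suc.prems(3) by (auto simp: W_def subspace_def linphi)
  have top: "\<forall>e'\<in>I. key e' > key e \<longrightarrow> \<phi> e' f = 0" for f
    using max by (meson not_less)
  have inv: "T f \<in> W" if "f \<in> W" for f
    using that Suc.prems(4)[of f] Suc.prems(6)[OF e(1) _ top, of f] by (auto simp: W_def)
  have sep: "f = 0" if "f \<in> W" "\<forall>e\<in>I - {e}. \<phi> e f = 0" for f
    using that Suc.prems(5)[of f] by (auto simp: W_def)
  have eig: "\<phi> e1 (T f) = ev e1 * \<phi> e1 f" if "e1 \<in> I - {e}" "f \<in> W"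
    "\<forall>e'\<in>I - {e}. key e' > key e1 \<longrightarrow> \<phi> e' f = 0" for e1 f
    using that Suc.prems(6)[of e1 f] by (auto simp: W_def)
  have card: "n = card (I - {e})"
    using Suc.hyps(2) Suc.prems(1) e(1) by simp
  have fin: "finite (I - {e})" and inj: "inj_on key (I - {e})"
    using Suc.prems(1,2) by (auto simp: inj_on_diff)
  obtain vs ss where IH: "length vs = length ss" "distinct vs" "independent (set vs)"
    "span (set vs) = W" "distinct ss"
    "set ss \<subseteq> {e1\<in>I - {e}. \<exists>f\<in>W. (\<forall>e'\<in>I - {e}. key e' > key e1 \<longrightarrow> \<phi> e' f = 0) \<and> \<phi> e1 f \<noteq> 0}"
    "\<forall>j<length ss. T (vs ! j) - ev (ss ! j) *\<^sub>R vs ! j \<in> span (set (take j vs))"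
    using Suc.hyps(1)[OF card fin inj subW] inv sep eig by force
  \<comment> \<open>Elements of \<open>W\<close> are killed by \<open>\<phi> e\<close>, so an index
    leading in \<open>W\<close> with respect to \<open>I - {e}\<close> is also leading in
    \<open>V\<close> with respect to \<open>I\<close>.\<close>
  have ss: "set ss \<subseteq> {e1\<in>I. \<exists>f\<in>V. (\<forall>e'\<in>I. key e' > key e1 \<longrightarrow> \<phi> e' f = 0) \<and> \<phi> e1 f \<noteq> 0}"
  proof
    fix e1 assume "e1 \<in> set ss"
    with IH(6) obtain f where "e1 \<in> I - {e}" "f \<in> W"
      "\<forall>e'\<in>I - {e}. key e' > key e1 \<longrightarrow> \<phi> e' f = 0" "\<phi> e1 f \<noteq> 0" by blast
    then show "e1 \<in> {e1\<in>I. \<exists>f\<in>V. (\<forall>e'\<in>I. key e' > key e1 \<longrightarrow> \<phi> e' f = 0) \<and> \<phi> e1 f \<noteq> 0}"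
      by (auto simp: W_def intro!: bexI[of _ f])
  qed
  show ?case
  proof (cases "W = V")
    case True
    with IH ss show ?thesis by blast
  next
    case False
    then obtain v where v: "v \<in> V" "\<phi> e v \<noteq> 0" by (auto simp: W_def)
    then have vW: "v \<notin> span (set vs)" using IH(4) by (auto simp: W_def)
    have "span (insert v (set vs)) = V"
    proof
      have "set vs \<subseteq> V" using IH(4) span_superset by (fastforce simp: W_def)
      then show "span (insert v (set vs)) \<subseteq> V" using v Suc.prems(3) by (intro span_minimal) auto
      show "V \<subseteq> span (insert v (set vs))"
      proof
        fix f assume f: "f \<in> V"
        have "f - (\<phi> e f / \<phi> e v) *\<^sub>R v \<in> W"
          using f v Suc.prems(3) by (auto simp: W_def linphi intro!: subspace_diff subspace_scale)
        then show "f \<in> span (insert v (set vs))"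
          unfolding span_breakdown_eq IH(4) by blast
      qed
    qed
    moreover have "v \<notin> set vs" using vW span_base by blast
    \<comment> \<open>Both terms have the same value under \<open>\<phi> e\<close>, so the
      difference lies in the span of the earlier basis vectors.\<close>
    moreover have "T v - ev e *\<^sub>R v \<in> W"
      using v Suc.prems(3,4) Suc.prems(6)[OF e(1) v(1) top]
      by (auto simp: W_def linphi intro!: subspace_diff subspace_scale)
    moreover have "e \<in> {e1\<in>I. \<exists>f\<in>V. (\<forall>e'\<in>I. key e' > key e1 \<longrightarrow> \<phi> e' f = 0) \<and> \<phi> e1 f \<noteq> 0}"
      using e(1) v top by blast
    moreover have "e \<notin> set ss" using IH(6) by auto
    ultimately show ?thesis
      using IH(1-5,7) ss vW
      by (intro exI[of _ "vs @ [v]"] exI[of _ "ss @ [e]"])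
        (auto simp: independent_insertI nth_append less_Suc_eq)
  qed
qed

text \<open>In this basis the matrix of \<open>T\<close> is upper triangular with diagonal
  \<open>\<mu>s\<close>, so its characteristic polynomial can be read off.\<close>

lemma eigenvalues_on_triangular:
  assumes "linear T" "length vs = length \<mu>s" "distinct vs" "independent (set vs)" "span (set vs) = V"
    and "\<And>j. j < length \<mu>s \<Longrightarrow> T (vs ! j) - \<mu>s ! j *\<^sub>R vs ! j \<in> span (set (take j vs))"
  shows "eigenvalues_on T V (mset \<mu>s)"
proof -
  define n where "n = length \<mu>s"
  have "\<exists>c. T (vs ! j) - \<mu>s ! j *\<^sub>R vs ! j = (\<Sum>i<j. c i *\<^sub>R vs ! i)" if "j < n" for j
  proof -
    have "T (vs ! j) - \<mu>s ! j *\<^sub>R vs ! j \<in> span (set (take j vs))"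
      using assms(6) that by (simp add: n_def)
    then obtain u where u: "T (vs ! j) - \<mu>s ! j *\<^sub>R vs ! j = (\<Sum>v\<in>set (take j vs). u v *\<^sub>R v)"
      by (auto simp: span_finite)
    have "bij_betw ((!) vs) {..<j} (set (take j vs))"
    proof -
      have "bij_betw ((!) (take j vs)) {..<j} (set (take j vs))"
        using assms(2,3) that by (intro bij_betw_nth) (auto simp: n_def)
      then show ?thesis by (rule bij_betw_cong[THEN iffD1, rotated]) auto
    qed
    then have "(\<Sum>v\<in>set (take j vs). u v *\<^sub>R v) = (\<Sum>i<j. u (vs ! i) *\<^sub>R vs ! i)"
      by (rule sum.reindex_bij_betw[symmetric])
    with u show ?thesis by metis
  qed
  then obtain c where c: "\<And>j. j < n \<Longrightarrow> T (vs ! j) - \<mu>s ! j *\<^sub>R vs ! j = (\<Sum>i<j. c j i *\<^sub>R vs ! i)"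
    by metis
  define A where "A = mat n n (\<lambda>(i, j). if i = j then \<mu>s ! j else if i < j then c j i else 0)"
  have A: "A \<in> carrier_mat n n" by (simp add: A_def)
  have "T (vs ! j) = (\<Sum>i<n. (A $$ (i, j)) *\<^sub>R (vs ! i))" if "j < n" for j
  proof -
    have "(\<Sum>i<n. (A $$ (i, j)) *\<^sub>R (vs ! i)) = (\<Sum>i<Suc j. (A $$ (i, j)) *\<^sub>R (vs ! i))"
      using that by (intro sum.mono_neutral_right) (auto simp: A_def)
    also have "\<dots> = (\<Sum>i<j. c j i *\<^sub>R vs ! i) + \<mu>s ! j *\<^sub>R vs ! j"
      using that by (auto simp: A_def intro!: sum.cong)
    also have "\<dots> = T (vs ! j)" using c[OF that] by (simp add: algebra_simps)
    finally show ?thesis by simp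
  qed
  moreover have "char_poly A = (\<Prod>\<mu>\<in>#mset \<mu>s. [:- \<mu>, 1:])"
  proof -
    have "upper_triangular A" by (auto simp: A_def)
    moreover have "diag_mat A = \<mu>s"
      by (rule nth_equalityI) (auto simp: diag_mat_def A_def n_def)
    ultimately show ?thesis
      by (simp add: char_poly_upper_triangular[OF A] flip: mset_map prod_mset_prod_list)
  qed
  ultimately show ?thesis
    unfolding eigenvalues_on_def using assms(1-5) A
    by (intro conjI exI[of _ n] exI[of _ vs] exI[of _ A]) (simp_all add: n_def)
qed

subsection \<open>Admissible sequences and partitions\<close>

text \<open>
  \<open>d\<^sub>i\<close> is the length of the \<open>i\<close>-th principal hook of the Young diagram, counted from the outside, and
  \<open>\<ell>\<^sub>i - 1\<close> is the number of parts 1, not counting the first part, of the diagram that is left after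
  removing \<open>i - 1\<close> hooks.
\<close>

fun hook_partition :: "(nat \<times> nat) list \<Rightarrow> nat list" where
  "hook_partition [] = []"
| "hook_partition ((e, m) # s) =
    (e + 1 - (m + sum_list (map snd s))) # map Suc (hook_partition s) @ replicate (m - 1) 1"

text \<open>Turns the indexed gap condition into a recursion on lists. The bounds
  \<open>e \<le> d\<close> and \<open>m \<le> l\<close> guard the truncated differences.\<close>

lemma admissible_Cons_iff:
  "(e, m) # s \<in> admissible d l \<longleftrightarrow> m \<ge> 1 \<and> e \<le> d \<and> m \<le> l \<and>
    (if s = [] then e = d \<and> m = l \<and> m \<le> e
     else e > fst (hd s) + m \<and> s \<in> admissible (d - e) (l - m))"
proof -
  have "(\<forall>i. Suc i < length ((e, m) # s) \<longrightarrow>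
      fst (((e, m) # s) ! i) > fst (((e, m) # s) ! Suc i) + snd (((e, m) # s) ! i)) \<longleftrightarrow>
    (s \<noteq> [] \<longrightarrow> e > fst (hd s) + m) \<and>
    (\<forall>i. Suc i < length s \<longrightarrow> fst (s ! i) > fst (s ! Suc i) + snd (s ! i))" (is "(\<forall>i. ?P i) \<longleftrightarrow> _")
  proof -
    have "(\<forall>i. ?P i) \<longleftrightarrow> ?P 0 \<and> (\<forall>i. ?P (Suc i))"
      by (metis not0_implies_Suc)
    also have "?P 0 \<longleftrightarrow> (s \<noteq> [] \<longrightarrow> e > fst (hd s) + m)"
      by (cases s) auto
    finally show ?thesis by simp
  qed
  then show ?thesis
    unfolding admissible_def by (cases "s = []") auto
qed

text \<open>Telescoping: the last entry starts with \<open>d_k \<ge> l_k\<close>, and each gap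
  \<open>d_i > d_(i+1) + l_i\<close> adds \<open>l_i\<close>. This keeps the first part of the hook
  partition positive.\<close>

lemma sum_snd_le_admissible:
  "s \<in> admissible d l \<Longrightarrow> l \<le> fst (hd s)"
proof (induction s arbitrary: d l)
  case (Cons x s)
  obtain e m where [simp]: "x = (e, m)" by force
  show ?case
    using Cons.prems Cons.IH[of "d - e" "l - m"]
    by (auto simp: admissible_Cons_iff split: if_splits)
qed (auto simp: admissible_def)

text \<open>The upper bound on the parts drives the induction: an inner part raised by 1 is at most
  \<open>d_2 + 2 - (l - l_1)\<close>, and the gap \<open>d_1 > d_2 + l_1\<close> makes this at most
  the new first part \<open>d_1 + 1 - l\<close>.\<close>

lemma hook_partition_props:
  assumes "s \<in> admissible d l"
  shows "length (hook_partition s) = l \<and> sum_list (hook_partition s) = d \<and>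
    (\<forall>x\<in>set (hook_partition s). 1 \<le> x \<and> x + l \<le> fst (hd s) + 1) \<and>
    sorted_wrt (\<ge>) (hook_partition s)"
  using assms
proof (induction s arbitrary: d l)
  case (Cons x s)
  obtain e m where [simp]: "x = (e, m)" by force
  have l: "l \<le> e" using sum_snd_le_admissible[OF Cons.prems] by simp
  have sums: "m + sum_list (map snd s) = l" using Cons.prems by (simp add: admissible_def)
  have rep: "sorted_wrt (\<ge>) (replicate k (1::nat))" for k
    by (induction k) auto
  show ?case
  proof (cases "s = []")
    case True
    with Cons.prems show ?thesis
      by (auto simp: admissible_Cons_iff sum_list_replicate rep[simplified])
  next
    case False
    with Cons.prems have s: "s \<in> admissible (d - e) (l - m)" "e > fst (hd s) + m" "m \<ge> 1" "e \<le> d" "m \<le> l"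
      by (auto simp: admissible_Cons_iff)
    note IH = Cons.IH[OF s(1)]
    define h where "h = map Suc (hook_partition s) @ replicate (m - 1) 1"
    have "sum_list (map Suc xs) = sum_list xs + length xs" for xs by (induction xs) auto
    then have "sum_list h = d - e + (l - m) + (m - 1)" "length h = l - m + (m - 1)"
      using IH by (simp_all add: h_def sum_list_replicate)
    moreover have "\<forall>x\<in>set h. 1 \<le> x \<and> x + l \<le> e + 1"
    proof
      fix x assume "x \<in> set h"
      then consider y where "y \<in> set (hook_partition s)" "x = Suc y" | "x = 1"
        by (auto simp: h_def)
      then show "1 \<le> x \<and> x + l \<le> e + 1"
      proof cases
        case 1
        with IH have "y + (l - m) \<le> fst (hd s) + 1" by blast
        with 1 s show ?thesis by linarith
      qed (use l in simp)
    qed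
    moreover have "sorted_wrt (\<ge>) h"
      using IH rep by (auto simp: h_def sorted_wrt_append sorted_wrt_map)
    \<comment> \<open>A hook of length \<open>e\<close> whose column has \<open>l\<close> cells has
      a row of \<open>e + 1 - l\<close> cells, the corner belonging to both.\<close>
    moreover have "hook_partition (x # s) = (e + 1 - l) # h"
      using sums by (simp add: h_def)
    ultimately show ?thesis
      using l s by auto
  qed
qed (auto simp: admissible_def)

text \<open>The first part gives back \<open>e\<close>. In the rest, the ones number
  \<open>m - 1\<close>, and the parts that are at least 2, lowered by 1, form the inner
  partition.\<close>

lemma hook_partition_inj:
  assumes "s \<in> admissible d l" "s' \<in> admissible d l" "hook_partition s = hook_partition s'"
  shows "s = s'"
  using assms
proof (induction s arbitrary: d l s')
  case (Cons x s)
  obtain e m where [simp]: "x = (e, m)" by force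
  obtain e' m' t where [simp]: "s' = (e', m') # t"
    using Cons.prems(2) by (cases s') (auto simp: admissible_def)
  have l: "l \<le> e" "l \<le> e'" using Cons.prems sum_snd_le_admissible[of _ d l] by fastforce+
  have sums: "m + sum_list (map snd s) = l" "m' + sum_list (map snd t) = l"
    using Cons.prems by (auto simp: admissible_def)
  have "Suc e - l = Suc e' - l" using Cons.prems(3) sums by simp
  with l have [simp]: "e' = e" by linarith
  have tail: "map Suc (hook_partition s) @ replicate (m - 1) 1 = map Suc (hook_partition t) @ replicate (m' - 1) 1"
    using Cons.prems(3) by simp
  have adm: "s = [] \<or> s \<in> admissible (d - e) (l - m)" "t = [] \<or> t \<in> admissible (d - e) (l - m')"
    "m \<ge> 1" "m' \<ge> 1"
    using Cons.prems by (auto simp: admissible_Cons_iff split: if_splits)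
  have take: "takeWhile (\<lambda>x. x \<ge> 2) (map Suc xs @ replicate k 1) = map Suc xs" if "\<forall>x\<in>set xs. x \<ge> 1"
    for xs and k :: nat
    using that by (induction xs) (auto simp: takeWhile_replicate)
  have "\<forall>x\<in>set (hook_partition s). x \<ge> 1" "\<forall>x\<in>set (hook_partition t). x \<ge> 1"
    using adm hook_partition_props by fastforce+
  then have "map Suc (hook_partition s) = map Suc (hook_partition t)"
    using arg_cong[OF tail, of "takeWhile (\<lambda>x. x \<ge> 2)"] by (simp only: take)
  then have eq: "hook_partition s = hook_partition t" by (simp add: inj_map_eq_map)
  with tail have "replicate (m - 1) (1::nat) = replicate (m' - 1) 1" by simp
  then have [simp]: "m' = m" using adm by (metis length_replicate le_add_diff_inverse2)
  have "s = t"
  proof (cases "s = [] \<or> t = []")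
    case True
    with eq show ?thesis by (cases s; cases t) auto
  next
    case False
    with adm eq Cons.IH[of "d - e" "l - m" t] show ?thesis by simp
  qed
  then show ?case by simp
qed (auto simp: admissible_def)

section \<open>Independence of monomials and a lower bound for the dimension\<close>

lemma monom_list_eq_single:
  "monom_list is = Poly_Mapping.single (\<Sum>i\<leftarrow>is. Poly_Mapping.single i 1) 1"
  by (induction "is") (simp_all add: var_def mult_single)

lemma monom_list_inj:
  assumes "monom_list is = monom_list js"
  shows "mset is = mset js"
proof -
  have "Poly_Mapping.lookup (\<Sum>i\<leftarrow>is. Poly_Mapping.single i (1::nat)) k = count (mset is) k" for "is" k
    by (induction "is") (auto simp: lookup_add lookup_single)
  moreover have "(\<Sum>i\<leftarrow>is. Poly_Mapping.single i (1::nat)) = (\<Sum>i\<leftarrow>js. Poly_Mapping.single i 1)"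
    using assms unfolding monom_list_eq_single
    by (metis lookup_single_eq lookup_single_not_eq zero_neq_one)
  ultimately show ?thesis by (metis multiset_eqI)
qed

lemma independent_single: "independent (range (\<lambda>m. Poly_Mapping.single m (1::real)))"
  unfolding independent_explicit_module
proof (intro allI impI)
  fix t :: "('a \<Rightarrow>\<^sub>0 real) set" and u v
  assume t: "finite t" "t \<subseteq> range (\<lambda>m. Poly_Mapping.single m 1)" "(\<Sum>v\<in>t. u v *\<^sub>R v) = 0" "v \<in> t"
  then obtain m where m: "v = Poly_Mapping.single m 1" by auto
  have "(\<Sum>w\<in>t. Poly_Mapping.lookup (u w *\<^sub>R w) m) = (\<Sum>w\<in>t. if w = v then u w else 0)"
  proof (rule sum.cong)
    fix w assume "w \<in> t"
    with t(2) obtain m' where "w = Poly_Mapping.single m' 1" by auto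
    then show "Poly_Mapping.lookup (u w *\<^sub>R w) m = (if w = v then u w else 0)"
      using m by (cases "m' = m") (auto simp: lookup_single dest: arg_cong[of _ _ "\<lambda>w. Poly_Mapping.lookup w m"])
  qed simp
  then have "Poly_Mapping.lookup (\<Sum>w\<in>t. u w *\<^sub>R w) m = u v"
    using t(1,4) by (simp add: lookup_sum)
  with t(3) show "u v = 0" by (metis lookup_zero)
qed

text \<open>Distinct hook partitions give distinct monomials, and these are independent. The
  opposite inequality will come from the leading exponents.\<close>

lemma card_admissible_le:
  assumes "finite B" "span B = F_space d l"
  shows "card (admissible d l) \<le> card B"
proof -
  let ?h = "\<lambda>s. monom_list (hook_partition s)"
  have "inj_on ?h (admissible d l)"
  proof (rule inj_onI)
    fix s t assume st: "s \<in> admissible d l" "t \<in> admissible d l" "?h s = ?h t"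
    then have "mset (rev (hook_partition s)) = mset (rev (hook_partition t))"
      using monom_list_inj[OF st(3)] by simp
    moreover have "sorted (rev (hook_partition s))" "sorted (rev (hook_partition t))"
      using hook_partition_props st by (auto simp: sorted_wrt_rev)
    ultimately have "hook_partition s = hook_partition t"
      by (metis properties_for_sort rev_is_rev_conv)
    with st show "s = t" by (intro hook_partition_inj)
  qed
  moreover have "independent (?h ` admissible d l)"
    by (rule independent_mono[OF independent_single]) (auto simp: monom_list_eq_single)
  moreover have "?h ` admissible d l \<subseteq> span B"
    using hook_partition_props monom_list_in_F_space assms(2) by fastforce
  ultimately show ?thesis
    using independent_span_bound[OF assms(1), of "?h ` admissible d l"] by (simp add: card_image)
qed

subsection \<open>Leading exponents\<close>

text \<open>The coefficient of the product of all \<open>c_j^(l_j) p_j^(d_j)\<close> in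
  \<open>f\<close> after substituting the sum of the \<open>c_j p_j^a\<close> for
  \<open>x_a\<close>. The base case takes the constant term, which sets the leftover variables to
  0.\<close>

primrec eval_seq :: "(nat \<times> nat) list \<Rightarrow> rpoly \<Rightarrow> real" where
  "eval_seq [] f = Poly_Mapping.lookup f 0"
| "eval_seq (x # s) f = eval_seq s (shift_coeff (int (snd x)) (int (fst x)) f)"

lemma seq_eigenvalue_Cons:
  "seq_eigenvalue ((e, m) # s) = (real m - 1) * (2 * real e - real m) / 2 + seq_eigenvalue s"
  by (simp add: seq_eigenvalue_def distrib_left)

text \<open>
  The sign makes a smaller \<open>m\<close> count as larger among sequences that start with the same \<open>e\<close>.
\<close>

primrec seq_key :: "(nat \<times> nat) list \<Rightarrow> int list" where
  "seq_key [] = []"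
| "seq_key (x # s) = int (fst x) # - int (snd x) # seq_key s"

definition seqs :: "nat \<Rightarrow> nat \<Rightarrow> (nat \<times> nat) list set" where
  "seqs d l = {s. (\<forall>x\<in>set s. snd x \<ge> 1) \<and> sum_list (map fst s) = d \<and> sum_list (map snd s) = l}"

lemma inj_seq_key: "inj seq_key"
proof (rule injI)
  show "seq_key s = seq_key t \<Longrightarrow> s = t" for s t
    by (induction s arbitrary: t; case_tac t) (auto simp: prod_eq_iff)
qed

lemma linear_eval_seq: "linear (eval_seq s)"
proof (induction s)
  case (Cons x s)
  then show ?case
    using linear_compose[OF linear_shift_coeff Cons] by (simp add: o_def)
qed (auto intro!: linearI simp: lookup_add)

lemma finite_seqs: "finite (seqs d l)"
proof (rule finite_subset)
  show "finite {s. set s \<subseteq> {..d} \<times> {..l} \<and> length s \<le> l}"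
    by (rule finite_lists_length_le) auto
  have "length s \<le> sum_list (map snd s)" if "\<forall>x\<in>set s. snd x \<ge> 1" for s :: "(nat \<times> nat) list"
    using that by (induction s) auto
  moreover have "fst x \<le> sum_list (map fst s) \<and> snd x \<le> sum_list (map snd s)"
    if "x \<in> set s" for x :: "nat \<times> nat" and s
    using that by (auto intro!: member_le_sum_list)
  ultimately show "seqs d l \<subseteq> {s. set s \<subseteq> {..d} \<times> {..l} \<and> length s \<le> l}"
    by (fastforce simp: seqs_def)
qed

lemma seqs_Cons_iff:
  "(e, m) # s \<in> seqs d l \<longleftrightarrow> m \<ge> 1 \<and> e \<le> d \<and> m \<le> l \<and> s \<in> seqs (d - e) (l - m)"
  by (auto simp: seqs_def)

text \<open>Sequences with all \<open>l_j = 1\<close> already separate: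
  \<open>shift_coeff 1 i\<close> is the \<open>i\<close>-th partial derivative, and by Euler's
  identity a form of positive degree whose derivatives all vanish is 0.\<close>

lemma eval_seq_separating:
  assumes "f \<in> F_space d l" "\<forall>s\<in>seqs d l. eval_seq s f = 0"
  shows "f = 0"
  using assms
proof (induction l arbitrary: d f)
  case 0
  show ?case
  proof (cases "d = 0")
    case True
    then have "[] \<in> seqs d 0" by (simp add: seqs_def)
    with 0(2) have "Poly_Mapping.lookup f 0 = 0" by force
    with F_space_0_eq[OF 0(1)] show ?thesis by simp
  qed (use F_space_0_pos[OF 0(1)] in simp)
next
  case (Suc l)
  show ?case
  proof (rule F_space_eqI_0[OF Suc.prems(1)])
    fix i assume i: "i \<in> {1..d}"
    have eq: "shift_coeff 1 (int i) f = partial i f"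
    proof -
      have "shift_coeff 1 (int i) f = (\<Sum>a=1..i. if a = i then partial a f else 0)"
        using shift_coeff_Suc[of 0 "int i" f] by (simp add: shift_coeff_0 if_distrib[of "partial _"] cong: if_cong)
      then show ?thesis using i by simp
    qed
    show "partial i f = 0"
    proof (rule Suc.IH)
      show "partial i f \<in> F_space (d - i) l"
        using partial_F_space[OF Suc.prems(1), of i] i by simp
      show "\<forall>s\<in>seqs (d - i) l. eval_seq s (partial i f) = 0"
      proof
        fix s assume "s \<in> seqs (d - i) l"
        then have "(i, 1) # s \<in> seqs d (Suc l)" using i by (auto simp: seqs_Cons_iff)
        with Suc.prems(2) show "eval_seq s (partial i f) = 0" by (force simp: eq)
      qed
    qed
  qed simp
qed

text \<open>Induction peels off the first shift. Eigenvalue and admissibility are treated together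
  because both rest on the vanishing of all coefficients beyond the leading one.\<close>

lemma eval_seq_T_op:
  assumes "s \<in> seqs d l" "f \<in> F_space d l"
    and "\<forall>t\<in>seqs d l. seq_key t > seq_key s \<longrightarrow> eval_seq t f = 0"
  shows "eval_seq s (T_op f) = seq_eigenvalue s * eval_seq s f \<and>
    (eval_seq s f \<noteq> 0 \<longrightarrow> s \<noteq> [] \<longrightarrow> s \<in> admissible d l)"
  using assms
proof (induction s arbitrary: d l f)
  case Nil
  then have "d = 0" "l = 0" by (auto simp: seqs_def)
  with Nil T_op_F_space_0 show ?case by (auto simp: seq_eigenvalue_def)
next
  case (Cons x t)
  obtain e m where x [simp]: "x = (e, m)" by force
  have t: "m \<ge> 1" "e \<le> d" "m \<le> l" "t \<in> seqs (d - e) (l - m)"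
    using Cons.prems(1) by (auto simp: seqs_Cons_iff)
  define g where "g = shift_coeff (int m) (int e) f"
  have g: "g \<in> F_space (d - e) (l - m)"
    unfolding g_def using Cons.prems(2) by (rule shift_coeff_F_space)
  show ?case
  proof (cases "e = 0")
    case True
    then have "shift_coeff (int m) (int e) h = 0" for h
      using t by (intro shift_coeff_eq_0) simp
    then show ?thesis by (simp add: linear_0[OF linear_eval_seq])
  next
    case False
    \<comment> \<open>The hypothesis only concerns the numbers \<open>eval_seq\<close>; separation
      upgrades it to the vanishing of whole polynomials, the form used by
      \<open>shift_coeff_T_op\<close> and \<open>shift_coeff_gap\<close>.\<close>
    have top: "shift_coeff m' e' f = 0" if "e' > int e \<or> e' = int e \<and> m' < int m" for m' e'
    proof -
      consider "m' < 0" | "m' = 0" | "e' > int d \<or> m' > int l" | "m' \<ge> 1" "e' \<le> int d" "m' \<le> int l"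
        by linarith
      then show ?thesis
      proof cases
        case 2
        then show ?thesis using that False by (auto simp: shift_coeff_0)
      next
        case 3
        then show ?thesis using shift_coeff_F_space_0[OF Cons.prems(2)] by blast
      next
        case 4
        define e1 m1 where "e1 = nat e'" "m1 = nat m'"
        have em: "e' = int e1" "m' = int m1" using 4 that False by (auto simp: e1_m1_def)
        show ?thesis
          unfolding em
        proof (rule eval_seq_separating)
          show "shift_coeff (int m1) (int e1) f \<in> F_space (d - e1) (l - m1)"
            using Cons.prems(2) by (rule shift_coeff_F_space)
          show "\<forall>s\<in>seqs (d - e1) (l - m1). eval_seq s (shift_coeff (int m1) (int e1) f) = 0"
          proof
            fix s assume "s \<in> seqs (d - e1) (l - m1)"
            then have "(e1, m1) # s \<in> seqs d l" using 4 em by (auto simp: seqs_Cons_iff)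
            moreover have "seq_key ((e1, m1) # s) > seq_key (x # t)"
              using that em by auto
            ultimately show "eval_seq s (shift_coeff (int m1) (int e1) f) = 0"
              using Cons.prems(3) by force
          qed
        qed
      qed auto
    qed
    have "\<forall>t'\<in>seqs (d - e) (l - m). seq_key t' > seq_key t \<longrightarrow> eval_seq t' g = 0"
    proof (intro ballI impI)
      fix t' assume "t' \<in> seqs (d - e) (l - m)" "seq_key t' > seq_key t"
      then have "(e, m) # t' \<in> seqs d l" "seq_key ((e, m) # t') > seq_key (x # t)"
        using t by (auto simp: seqs_Cons_iff)
      with Cons.prems(3) show "eval_seq t' g = 0" by (force simp: g_def)
    qed
    note IH = Cons.IH[OF t(4) g this]
    have "eval_seq (x # t) (T_op f) = eval_seq t (T_op g) +
        (of_int (int m - 1) * of_int (2 * int e - int m) / 2) * eval_seq t g"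
    proof -
      have "shift_coeff (int m) (int e) (T_op f) = T_op g +
          (of_int (int m - 1) * of_int (2 * int e - int m) / 2) *\<^sub>R g"
        unfolding g_def by (rule shift_coeff_T_op) (use False top in auto)
      then show ?thesis
        by (simp add: linear_add[OF linear_eval_seq] linear_scale[OF linear_eval_seq])
    qed
    also have "\<dots> = seq_eigenvalue (x # t) * eval_seq t g"
      using IH by (simp add: seq_eigenvalue_Cons algebra_simps)
    finally have 1: "eval_seq (x # t) (T_op f) = seq_eigenvalue (x # t) * eval_seq (x # t) f"
      by (simp add: g_def)
    have "x # t \<in> admissible d l" if nz: "eval_seq (x # t) f \<noteq> 0"
    proof -
      have g0: "eval_seq t g \<noteq> 0" "g \<noteq> 0"
        using nz by (auto simp: g_def linear_0[OF linear_eval_seq])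
      show ?thesis
      proof (cases t)
        case Nil
        \<comment> \<open>A nonzero coefficient has at least as many powers of \<open>p\<close> as
          of \<open>c\<close>; for the last entry this is \<open>d_k \<ge> l_k\<close>.\<close>
        have "m \<le> e" using g0(2) shift_coeff_eq_0[of "int e" "int m" f] by (force simp: g_def)
        with Nil t show ?thesis by (auto simp: admissible_Cons_iff seqs_def)
      next
        case (Cons y t2)
        obtain e2 m2 where y: "y = (e2, m2)" by force
        have "m2 \<ge> 1" using t(4) Cons y by (auto simp: seqs_Cons_iff)
        moreover have "shift_coeff (int m2) (int e2) g \<noteq> 0"
          using g0 Cons y by (auto simp: linear_0[OF linear_eval_seq])
        ultimately have "\<not> (int e2 + int m \<ge> int e)"
          using shift_coeff_gap[of "int m" "int e" "int m2" "int e2" f] top t(1) False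
          by (auto simp: g_def)
        moreover have "t \<in> admissible (d - e) (l - m)" using IH g0 Cons by auto
        ultimately show ?thesis using t Cons y by (auto simp: admissible_Cons_iff)
      qed
    qed
    with 1 show ?thesis by blast
  qed
qed

section \<open>Matching the leading exponents with the admissible sequences\<close>

theorem theorem5:
  fixes d l :: nat
  assumes "d \<ge> l" and "l \<ge> 1"
  shows "eigenvalues_on T_op (F_space d l) (image_mset seq_eigenvalue (mset_set (admissible d l)))"
proof -
  obtain vs ss where vs: "length vs = length ss" "distinct vs" "independent (set vs)"
    "span (set vs) = F_space d l" "distinct ss"
    and ss: "set ss \<subseteq> {e\<in>seqs d l. \<exists>f\<in>F_space d l.
      (\<forall>e'\<in>seqs d l. seq_key e' > seq_key e \<longrightarrow> eval_seq e' f = 0) \<and> eval_seq e f \<noteq> 0}"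
    and tri: "\<forall>j<length ss. T_op (vs ! j) - seq_eigenvalue (ss ! j) *\<^sub>R vs ! j \<in> span (set (take j vs))"
  proof -
    have "\<exists>vs ss. length vs = length ss \<and> distinct vs \<and> independent (set vs) \<and> span (set vs) = F_space d l \<and>
      distinct ss \<and>
      set ss \<subseteq> {e\<in>seqs d l. \<exists>f\<in>F_space d l.
        (\<forall>e'\<in>seqs d l. seq_key e' > seq_key e \<longrightarrow> eval_seq e' f = 0) \<and> eval_seq e f \<noteq> 0} \<and>
      (\<forall>j<length ss. T_op (vs ! j) - seq_eigenvalue (ss ! j) *\<^sub>R vs ! j \<in> span (set (take j vs)))"
    proof (rule triangular_basis_exists[where key = seq_key and \<phi> = eval_seq and ev = seq_eigenvalue])
      show "inj_on seq_key (seqs d l)" using inj_seq_key by (rule inj_on_subset) simp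
      show "eval_seq e (T_op f) = seq_eigenvalue e * eval_seq e f"
        if "e \<in> seqs d l" "f \<in> F_space d l" "\<forall>e'\<in>seqs d l. seq_key e' > seq_key e \<longrightarrow> eval_seq e' f = 0" for e f
        using eval_seq_T_op[OF that] by (rule conjunct1)
      show "f = 0" if "f \<in> F_space d l" "\<forall>e\<in>seqs d l. eval_seq e f = 0" for f
        using that by (rule eval_seq_separating)
      show "T_op f \<in> F_space d l" if "f \<in> F_space d l" for f
        using that by (rule T_op_F_space)
    qed (rule finite_seqs linear_T_op linear_eval_seq subspace_F_space)+
    then show thesis by (elim exE conjE) (rule that)
  qed
  have sub: "set ss \<subseteq> admissible d l"
  proof
    fix s assume "s \<in> set ss"
    with ss obtain f where f: "s \<in> seqs d l" "f \<in> F_space d l" "eval_seq s f \<noteq> 0"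
      "\<forall>e'\<in>seqs d l. seq_key e' > seq_key s \<longrightarrow> eval_seq e' f = 0" by blast
    moreover have "s \<noteq> []" using f(1) assms(2) by (auto simp: seqs_def)
    ultimately show "s \<in> admissible d l" using eval_seq_T_op by blast
  qed
  \<comment> \<open>The list \<open>ss\<close> is as long as the basis \<open>vs\<close>, and the
    dimension is at least the number of admissible sequences. With the inclusion \<open>sub\<close>,
    each admissible sequence occurs exactly once.\<close>
  moreover have "card (admissible d l) \<le> card (set ss)"
    using card_admissible_le[of "set vs" d l] vs by (simp add: distinct_card)
  ultimately have "set ss = admissible d l"
    using finite_admissible by (intro card_seteq)
  then have "mset ss = mset_set (admissible d l)"
    using mset_set_set[OF vs(5)] by simp
  moreover have "eigenvalues_on T_op (F_space d l) (mset (map seq_eigenvalue ss))"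
    by (rule eigenvalues_on_triangular[OF linear_T_op _ vs(2-4)]) (use vs tri in auto)
  ultimately show ?thesis by simp
qed

end
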